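(* Let $X=W/\langle f\rangle$ be a Hopf manifold of dimension $n\ge 3$, where $f(z_1,\dots,z_n)=(\mu_1z_1,\dots,\mu_nz_n)$, and let $\mathcal F$ be a nonsingular one-dimensional holomorphic foliation on $X$ given by a morphism $T_{\mathcal F}=L_b\to TX$, $b\in\mathbb C^*$. Then the following holds. (i) If $X$ is classical (with $\mu_1=\dots=\mu_n=\mu$), then $b=\mu^{-m}$ for some integer $m\ge -1$. The foliation $\mathcal F$ is induced by a polynomial vector field $g_1\frac{\partial}{\partial z_1}+\dots+g_n\frac{\partial}{\partial z_n}$, where the $g_i$ are homogeneous polynomials of the same degree $m+1$ for all $1\le i\le n$, with $\{g_1=\dots=g_n=0\}=\{0\}$. (ii) If $X$ is generic, then $b\in\{1,\mu_1,\dots,\mu_n\}$. The foliation $\mathcal F$ is induced by a constant vector field. (iii) If $X$ is intermediary (with $\mu_1=\dots=\mu_r$, $2\le r\le n-1$), then $b\in\{1,\mu_1,\mu_{r+1},\mu_{r+2},\dots,\mu_n\}$, and the vector field inducing $\mathcal F$ is as follows: - if $T_{\mathcal F}=L_1$: $\sum_{j=1}^r g_j(z_1,\dots,z_r)\frac{\partial}{\partial z_j}+\sum_{k=r+1}^n c^kz_k\frac{\partial}{\partial z_k}$, where the $g_j$ are functions of $z_1,\dots,z_r$ only and the $c^k$ are constants; - if $T_{\mathcal F}=L_{\mu_1}$: $c^1\frac{\partial}{\partial z_1}+\dots+c^r\frac{\partial}{\partial z_r}$ with constants $c^i\ne 0$ for all $i$; - if $T_{\mathcal F}=L_{\mu_j}$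 with $j>r$: $\frac{\partial}{\partial z_j}$.
   Context: Let $n\ge 2$, $W=\mathbb C^n\setminus\{0\}$, and $f(z_1,\dots,z_n)=(\mu_1z_1,\dots,\mu_nz_n)$ with $0<|\mu_i|<1$ for all $i$. The compact complex manifold $X=W/\langle f\rangle$ of dimension $n$ is called a Hopf manifold. Types of Hopf manifolds. $X$ is classical if $\mu_1=\dots=\mu_n=:\mu$. $X$ is generic if $0<|\mu_1|\le\dots\le|\mu_n|<1$ and there is no non-trivial relation $\prod_{i\in A}\mu_i^{r_i}=\prod_{j\in B}\mu_j^{r_j}$ with $r_i,r_j\in\mathbb N$, $A\cap B=\emptyset$, $A\cup B=\{1,\dots,n\}$. $X$ is intermediary if $\mu_1=\dots=\mu_r$ for some $2\le r\le n-1$ and there is no non-trivial relation $\prod_{i\in A}\mu_i^{r_i}=\prod_{j\in B}\mu_j^{r_j}$ with $r_i,r_j\in\mathbb N$, $A\cap B=\emptyset$, $A\cup B=\{1,r+1,\dots,n\}$. For $b\in\mathbb C^*$, $L_b$ is the line bundle on $X$ obtained as the quotient of $W\times\mathbb C$ by $(z,v)\mapsto(f(z),bv)$; every line bundle on $X$ is of this form. A nonsingular one-dimensional foliation $\mathcal F$ on $X$ is given by a line bundle $T_{\mathcal F}=L_b$ (its tangent bundle) and an embedding $L_b\to TX$, i.e. a nowhere vanishing section of $TX\otimes L_{b^{-1}}$. Such a section corresponds to a holomorphic vector field $v=\sum_k g_k\,\partial/\partial z_k$ on $W$ with $g_k(f(z))=\mu_kb^{-1}g_k(z)$ for all $k$;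 one says that $\mathcal F$ is induced by $v$.
   Formalization: Corrected: in (i) the zero set is empty when m = -1; in (ii) the field is constant only for b ≠ 1, and for b = 1 it is Σ c^k z_k ∂/∂z_k; in (iii) for L_{μ_1} the constants c^i are not all zero, instead of all nonzero. *)

theory Defs
  imports "HOL-Analysis.Analysis"
begin

text \<open>Orbits of the infinite cyclic group generated by a bijection \<open>F\<close>. Negative powers are
  expressed by exchanging the two points.\<close>

definition cyclic_orbit :: "('a \<Rightarrow> 'a) \<Rightarrow> 'a \<Rightarrow> 'a set" where
  "cyclic_orbit F p = {q. \<exists>n. q = (F ^^ n) p \<or> p = (F ^^ n) q}"

text \<open>Holomorphic maps between complex vector spaces: complex-linear Frechet derivative at every
  point. Only used for open \<open>U\<close>.\<close>

definition holomorphic_map_on :: "(complex^'n \<Rightarrow> complex^'m) \<Rightarrow> (complex^'n) set \<Rightarrow> bool" where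
  "holomorphic_map_on g U \<longleftrightarrow>
     (\<forall>z\<in>U. \<exists>D. (g has_derivative D) (at z) \<and> Vector_Spaces.linear (*s) (*s) D)"

definition punctured_space :: "(complex^'n) set" where
  "punctured_space = - {0}"

definition diag_map :: "complex^'n \<Rightarrow> complex^'n \<Rightarrow> complex^'n" where
  "diag_map \<mu> z = (\<chi> i. \<mu> $ i * z $ i)"

definition line_action :: "complex^'n \<Rightarrow> complex \<Rightarrow> (complex^'n) \<times> complex \<Rightarrow> (complex^'n) \<times> complex" where
  "line_action \<mu> b = (\<lambda>(z, v). (diag_map \<mu> z, b * v))"

definition tangent_action :: "complex^'n \<Rightarrow> (complex^'n) \<times> (complex^'n) \<Rightarrow> (complex^'n) \<times> (complex^'n)" where
  "tangent_action \<mu> = (\<lambda>(z, w). (diag_map \<mu> z, frechet_derivative (diag_map \<mu>) (at z) w))"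

text \<open>Let \<open>W = \<complex>\<^sup>n - {0}\<close>. The Hopf manifold is \<open>X = W / \<langle>diag_map \<mu>\<rangle>\<close>. The total spaces of \<open>L\<^sub>b\<close>
  and of \<open>TX\<close> are the sets of classes \<open>line_class \<mu> b z v\<close> and \<open>tangent_class \<mu> z w\<close>, with
  \<open>z\<close> in \<open>W\<close>. Over the image in \<open>X\<close> of a sufficiently small open subset of \<open>W\<close>, these
  classes are the local trivialisations of the two bundles.\<close>

definition line_class :: "complex^'n \<Rightarrow> complex \<Rightarrow> complex^'n \<Rightarrow> complex \<Rightarrow> ((complex^'n) \<times> complex) set" where
  "line_class \<mu> b z v = cyclic_orbit (line_action \<mu> b) (z, v)"

definition tangent_class :: "complex^'n \<Rightarrow> complex^'n \<Rightarrow> complex^'n \<Rightarrow> ((complex^'n) \<times> (complex^'n)) set" where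
  "tangent_class \<mu> z w = cyclic_orbit (tangent_action \<mu>) (z, w)"

definition line_bundle :: "complex^'n \<Rightarrow> complex \<Rightarrow> ((complex^'n) \<times> complex) set set" where
  "line_bundle \<mu> b = {line_class \<mu> b z v | z v. z \<in> punctured_space}"

text \<open>A morphism of holomorphic vector bundles \<open>L\<^sub>b \<rightarrow> TX\<close> over the identity of \<open>X\<close>: in the local
  trivialisations it is \<open>(z, v) \<mapsto> (z, A(z) v)\<close> with \<open>A\<close> holomorphic. The linear map \<open>A(z)\<close>
  from \<open>\<complex>\<close> to \<open>\<complex>\<^sup>n\<close> is given by the image of 1.\<close>

definition line_tangent_morphism ::
    "complex^'n \<Rightarrow> complex \<Rightarrow> (((complex^'n) \<times> complex) set \<Rightarrow> ((complex^'n) \<times> (complex^'n)) set) \<Rightarrow> bool" where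
  "line_tangent_morphism \<mu> b \<phi> \<longleftrightarrow>
     (\<forall>z0 \<in> punctured_space. \<exists>U A. open U \<and> z0 \<in> U \<and> U \<subseteq> punctured_space \<and>
        holomorphic_map_on A U \<and>
        (\<forall>z\<in>U. \<forall>v. \<phi> (line_class \<mu> b z v) = tangent_class \<mu> z (v *s A z)))"

definition line_tangent_embedding ::
    "complex^'n \<Rightarrow> complex \<Rightarrow> (((complex^'n) \<times> complex) set \<Rightarrow> ((complex^'n) \<times> (complex^'n)) set) \<Rightarrow> bool" where
  "line_tangent_embedding \<mu> b \<phi> \<longleftrightarrow> line_tangent_morphism \<mu> b \<phi> \<and> inj_on \<phi> (line_bundle \<mu> b)"

text \<open>A foliation is represented by its line subbundle of \<open>TX\<close> (as a subset of the total space).\<close>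

definition nonsingular_foliation ::
    "complex^'n \<Rightarrow> complex \<Rightarrow> ((complex^'n) \<times> (complex^'n)) set set \<Rightarrow> bool" where
  "nonsingular_foliation \<mu> b \<F> \<longleftrightarrow>
     (\<exists>\<phi>. line_tangent_embedding \<mu> b \<phi> \<and> \<F> = \<phi> ` line_bundle \<mu> b)"

text \<open>A vector field \<open>\<Sum>k. g\<^sub>k \<partial>/\<partial>z\<^sub>k\<close> is given by its coefficient map \<open>g\<close>, of which only the
  values on \<open>W\<close> matter here.\<close>

definition induced_by ::
    "complex^'n \<Rightarrow> complex \<Rightarrow> ((complex^'n) \<times> (complex^'n)) set set \<Rightarrow> (complex^'n \<Rightarrow> complex^'n) \<Rightarrow> bool" where
  "induced_by \<mu> b \<F> g \<longleftrightarrow>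
     holomorphic_map_on g punctured_space \<and>
     (\<forall>z \<in> punctured_space. g z \<noteq> 0) \<and>
     (\<forall>z \<in> punctured_space. \<forall>k. g (diag_map \<mu> z) $ k = \<mu> $ k * inverse b * g z $ k) \<and>
     \<F> = {tangent_class \<mu> z (c *s g z) | z c. z \<in> punctured_space}"

text \<open>The coordinates are indexed by a finite linearly ordered type, so that \<open>z\<^sub>1, \<dots>, z\<^sub>n\<close> are the
  coordinates with indices of positions \<open>1, \<dots>, n\<close>.\<close>

definition position :: "'n::{finite,linorder} \<Rightarrow> nat" where
  "position i = card {..i}"

definition hopf_data :: "complex^'n \<Rightarrow> bool" where
  "hopf_data \<mu> \<longleftrightarrow> CARD('n) \<ge> 2 \<and> (\<forall>i. 0 < cmod (\<mu> $ i) \<and> cmod (\<mu> $ i) < 1)"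

text \<open>The exponents are allowed to be 0; the trivial relation is the one with all exponents 0.\<close>

definition no_nontrivial_relation :: "complex^'n \<Rightarrow> 'n set \<Rightarrow> bool" where
  "no_nontrivial_relation \<mu> S \<longleftrightarrow>
     (\<forall>A B (\<rho> :: 'n \<Rightarrow> nat). A \<inter> B = {} \<and> A \<union> B = S \<and>
        (\<Prod>i\<in>A. \<mu> $ i ^ \<rho> i) = (\<Prod>j\<in>B. \<mu> $ j ^ \<rho> j) \<longrightarrow> (\<forall>i\<in>S. \<rho> i = 0))"

definition classical_hopf :: "complex^'n \<Rightarrow> complex \<Rightarrow> bool" where
  "classical_hopf \<mu> \<nu> \<longleftrightarrow> hopf_data \<mu> \<and> (\<forall>i. \<mu> $ i = \<nu>)"

definition generic_hopf :: "complex^'n::{finite,linorder} \<Rightarrow> bool" where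
  "generic_hopf \<mu> \<longleftrightarrow> hopf_data \<mu> \<and> mono (\<lambda>i. cmod (\<mu> $ i)) \<and> no_nontrivial_relation \<mu> UNIV"

definition intermediary_hopf :: "complex^'n::{finite,linorder} \<Rightarrow> nat \<Rightarrow> bool" where
  "intermediary_hopf \<mu> r \<longleftrightarrow> hopf_data \<mu> \<and> 2 \<le> r \<and> r \<le> CARD('n) - 1 \<and>
     (\<forall>i j. position i \<le> r \<and> position j \<le> r \<longrightarrow> \<mu> $ i = \<mu> $ j) \<and>
     no_nontrivial_relation \<mu> {i. position i = 1 \<or> r < position i}"

definition homogeneous_polynomial :: "nat \<Rightarrow> (complex^'n \<Rightarrow> complex) \<Rightarrow> bool" where
  "homogeneous_polynomial d p \<longleftrightarrow>
     (\<exists>a :: ('n \<Rightarrow> nat) \<Rightarrow> complex.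
        \<forall>z. p z = (\<Sum>\<alpha> | (\<Sum>i\<in>UNIV. \<alpha> i) = d. a \<alpha> * (\<Prod>i\<in>UNIV. z $ i ^ \<alpha> i)))"

end

theory Submission
  imports
    Defs
    "HOL-Complex_Analysis.Cauchy_Integral_Formula"
    "HOL-Computational_Algebra.Polynomial"
begin

text \<open>
  Lifting to \<open>W\<close>. The group generated by \<open>f\<close> acts freely on \<open>W\<close>, so a class in the total
  space of \<open>L\<^sub>b\<close> or of \<open>TX\<close> has exactly one representative over a given point \<open>z\<close>. An embedding
  \<open>L\<^sub>b \<rightarrow> TX\<close> therefore is multiplication by a global vector field \<open>g\<close> on \<open>W\<close>, holomorphic and
  nowhere zero, and compatibility with the two actions reads \<open>g\<^sub>k \<circ> f = (\<mu>\<^sub>k / b) g\<^sub>k\<close>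
  (\<open>foliation_induced_by_vector_field\<close>).

  Each \<open>g\<^sub>k\<close> is a polynomial. Every orbit of the contraction \<open>f\<close> meets
  a compact spherical shell, so \<open>g\<^sub>k \<circ> f = \<nu> g\<^sub>k\<close> forces polynomial growth at infinity. A line parallel
  to the \<open>i\<close>-th axis through a point without zero coordinates misses the origin, because there is
  another coordinate. By Liouville's theorem, \<open>g\<^sub>k\<close> is on all such lines a polynomial of bounded
  degree, and Lagrange interpolation in one coordinate after another makes it a polynomial on
  \<open>(\<complex>\<^sup>*)\<^sup>n\<close>, which is dense in \<open>W\<close>. Monomials are eigenfunctions of \<open>h \<mapsto> h \<circ> f\<close>, the monomial
  \<open>z\<^sup>\<alpha>\<close> having eigenvalue \<open>\<mu>\<^sup>\<alpha>\<close>; so only those with \<open>\<mu>\<^sup>\<alpha> = \<mu>\<^sub>k / b\<close> survive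
  (\<open>equivariant_component_expansion\<close>).

  The three types. What remains is to solve \<open>\<mu>\<^sup>\<alpha> b = \<mu>\<^sub>k\<close>. In the classical case the equation fixes
  the degree of \<open>\<alpha>\<close>. The generic and the intermediary case are treated together: the indices are
  divided into classes of equal multipliers, and one representative of each class is taken, so that the
  representatives are multiplicatively independent. As \<open>g\<close> does not vanish on the \<open>i\<close>-th axis, some
  \<open>g\<^sub>k\<close> contains a power of \<open>z\<^sub>i\<close> alone, whence \<open>\<mu>\<^sub>i\<^sup>m b = \<mu>\<^sub>k\<close> for some \<open>m\<close>. Comparing these
  relations for two indices of different classes leaves only \<open>b = 1\<close> and \<open>b = \<mu>\<^sub>l\<close>
  (\<open>twist_is_one_or_multiplier\<close>). Given \<open>b\<close>, independence leaves only linear monomials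
  in the first case and only constants in the second.
\<close>

section \<open>Polynomial functions of several complex variables\<close>

definition monomial_fun :: "('n::finite \<Rightarrow> nat) \<Rightarrow> complex^'n \<Rightarrow> complex" where
  "monomial_fun \<alpha> z = (\<Prod>i\<in>UNIV. z $ i ^ \<alpha> i)"

definition unit_exponent :: "'n \<Rightarrow> 'n \<Rightarrow> nat" where
  "unit_exponent k = (\<lambda>j. if j = k then 1 else 0)"

lemma monomial_fun_unit:
  "monomial_fun (\<lambda>j. m * unit_exponent k j) z = z $ k ^ m"
proof -
  have "monomial_fun (\<lambda>j. m * unit_exponent k j) z = (\<Prod>j\<in>UNIV. if j = k then z $ j ^ m else 1)"
    unfolding monomial_fun_def by (rule prod.cong) (auto simp: unit_exponent_def)
  then show ?thesis by simp
qed

lemma monomial_fun_unit_1 [simp]: "monomial_fun (unit_exponent k) z = z $ k"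
  using monomial_fun_unit[of 1 k z] by simp

lemma monomial_fun_add:
  "monomial_fun (\<lambda>j. \<alpha> j + \<beta> j) z = monomial_fun \<alpha> z * monomial_fun \<beta> z"
  by (simp add: monomial_fun_def power_add prod.distrib)

lemma monomial_fun_0 [simp]: "monomial_fun (\<lambda>j. 0) z = 1"
  by (simp add: monomial_fun_def)

definition polynomial_fun :: "(complex^'n::finite \<Rightarrow> complex) \<Rightarrow> bool" where
  "polynomial_fun p \<longleftrightarrow>
     (\<exists>E a. finite E \<and> (\<forall>z. p z = (\<Sum>\<alpha>\<in>E. a \<alpha> * monomial_fun \<alpha> z)))"

lemma polynomial_funI:
  "finite E \<Longrightarrow> (\<And>z. p z = (\<Sum>\<alpha>\<in>E. a \<alpha> * monomial_fun \<alpha> z)) \<Longrightarrow> polynomial_fun p"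
  unfolding polynomial_fun_def by blast

lemma polynomial_fun_monomial: "polynomial_fun (\<lambda>z. c * monomial_fun \<alpha> z)"
  by (rule polynomial_funI[of "{\<alpha>}" _ "\<lambda>_. c"]) auto

lemma polynomial_fun_const: "polynomial_fun (\<lambda>z. c)"
  using polynomial_fun_monomial[of c "\<lambda>_. 0"] by (simp add: monomial_fun_def)

lemma polynomial_fun_add:
  assumes "polynomial_fun p" "polynomial_fun q"
  shows "polynomial_fun (\<lambda>z. p z + q z)"
proof -
  obtain E a F c where E: "finite E" "\<And>z. p z = (\<Sum>\<alpha>\<in>E. a \<alpha> * monomial_fun \<alpha> z)"
    and F: "finite F" "\<And>z. q z = (\<Sum>\<alpha>\<in>F. c \<alpha> * monomial_fun \<alpha> z)"
    using assms unfolding polynomial_fun_def by blast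
  have "p z + q z = (\<Sum>\<alpha>\<in>E \<union> F. ((if \<alpha> \<in> E then a \<alpha> else 0) + (if \<alpha> \<in> F then c \<alpha> else 0))
          * monomial_fun \<alpha> z)" for z
  proof -
    have "p z = (\<Sum>\<alpha>\<in>E \<union> F. (if \<alpha> \<in> E then a \<alpha> else 0) * monomial_fun \<alpha> z)"
      unfolding E(2) by (rule sum.mono_neutral_cong_left) (use E F in auto)
    moreover have "q z = (\<Sum>\<alpha>\<in>E \<union> F. (if \<alpha> \<in> F then c \<alpha> else 0) * monomial_fun \<alpha> z)"
      unfolding F(2) by (rule sum.mono_neutral_cong_left) (use E F in auto)
    ultimately show ?thesis by (simp add: ring_distribs sum.distrib)
  qed
  with E(1) F(1) show ?thesis by (intro polynomial_funI[of "E \<union> F"]) auto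
qed

lemma polynomial_fun_sum:
  assumes "\<And>x. x \<in> A \<Longrightarrow> polynomial_fun (p x)"
  shows "polynomial_fun (\<lambda>z. \<Sum>x\<in>A. p x z)"
  using assms
  by (induction A rule: infinite_finite_induct)
     (auto intro: polynomial_fun_const polynomial_fun_add)

lemma polynomial_fun_mult:
  assumes "polynomial_fun p" "polynomial_fun q"
  shows "polynomial_fun (\<lambda>z. p z * q z)"
proof -
  obtain E a F c where E: "\<And>z. p z = (\<Sum>\<alpha>\<in>E. a \<alpha> * monomial_fun \<alpha> z)"
    and F: "\<And>z. q z = (\<Sum>\<alpha>\<in>F. c \<alpha> * monomial_fun \<alpha> z)"
    using assms unfolding polynomial_fun_def by blast
  have "p z * q z = (\<Sum>\<alpha>\<in>E. \<Sum>\<beta>\<in>F. (a \<alpha> * c \<beta>) * monomial_fun (\<lambda>i. \<alpha> i + \<beta> i) z)" for z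
    unfolding E F sum_product
    by (simp add: monomial_fun_def power_add prod.distrib mult_ac)
  then show ?thesis
    by (simp only:) (intro polynomial_fun_sum polynomial_fun_monomial)
qed

lemma polynomial_fun_coordinate: "polynomial_fun (\<lambda>z. z $ i)"
  using polynomial_fun_monomial[of 1 "unit_exponent i"] by simp

lemma polynomial_fun_power:
  "polynomial_fun p \<Longrightarrow> polynomial_fun (\<lambda>z. p z ^ m)"
  by (induction m) (auto intro: polynomial_fun_const polynomial_fun_mult)

lemma polynomial_fun_prod:
  assumes "\<And>x. x \<in> A \<Longrightarrow> polynomial_fun (p x)"
  shows "polynomial_fun (\<lambda>z. \<Prod>x\<in>A. p x z)"
  using assms
  by (induction A rule: infinite_finite_induct)
     (auto intro: polynomial_fun_const polynomial_fun_mult)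

lemma polynomial_fun_poly:
  "polynomial_fun p \<Longrightarrow> polynomial_fun (\<lambda>z. poly q (p z))"
  unfolding poly_altdef
  by (intro polynomial_fun_sum polynomial_fun_mult polynomial_fun_const polynomial_fun_power)

definition coordinate_update :: "complex^'n \<Rightarrow> 'n \<Rightarrow> complex \<Rightarrow> complex^'n" where
  "coordinate_update z i t = (\<chi> j. if j = i then t else z $ j)"

lemma coordinate_update_nth [simp]:
  "coordinate_update z i t $ j = (if j = i then t else z $ j)"
  by (simp add: coordinate_update_def)

lemma coordinate_update_self [simp]: "coordinate_update z i (z $ i) = z"
  by (simp add: vec_eq_iff)

lemma polynomial_fun_coordinate_update:
  assumes "polynomial_fun p"
  shows "polynomial_fun (\<lambda>z. p (coordinate_update z i c))"
proof -
  obtain E a where E: "\<And>z. p z = (\<Sum>\<alpha>\<in>E. a \<alpha> * monomial_fun \<alpha> z)"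
    using assms unfolding polynomial_fun_def by blast
  have "polynomial_fun (\<lambda>z. coordinate_update z i c $ j)" for j
    by (cases "j = i") (auto intro: polynomial_fun_const polynomial_fun_coordinate)
  then show ?thesis
    unfolding E monomial_fun_def
    by (intro polynomial_fun_sum polynomial_fun_mult polynomial_fun_const polynomial_fun_prod
        polynomial_fun_power)
qed

section \<open>Separately polynomial functions\<close>

text \<open>
  Both sides are polynomials of degree less than \<open>card X\<close> that agree on \<open>X\<close>.
\<close>

lemma lagrange_interpolation:
  fixes q :: "'a::field poly"
  assumes "finite X" "degree q < card X"
  shows "poly q t = (\<Sum>x\<in>X. poly q x * poly (\<Prod>y\<in>X - {x}. smult (inverse (x - y)) [:- y, 1:]) t)"
proof -
  define L where "L x = (\<Prod>y\<in>X - {x}. smult (inverse (x - y)) [:- y, 1:])" for x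
  define r where "r = (\<Sum>x\<in>X. smult (poly q x) (L x))"
  have deg_L: "degree (L x) < card X" if "x \<in> X" for x
  proof -
    have "degree (L x) \<le> (\<Sum>y\<in>X - {x}. degree (smult (inverse (x - y)) [:- y, 1:]))"
      unfolding L_def by (rule order_trans[OF degree_prod_sum_le]) (use assms in \<open>auto simp: o_def\<close>)
    also have "\<dots> \<le> (\<Sum>y\<in>X - {x}. 1)"
      by (rule sum_mono) auto
    also have "\<dots> < card X"
      using card_Diff1_less[OF assms(1) that] by simp
    finally show ?thesis .
  qed
  have "q = r"
  proof (rule poly_eqI_degree)
    show "card X > degree q" by fact
    have "degree r \<le> card X - 1"
      unfolding r_def
      by (rule degree_sum_le) (use assms deg_L in \<open>force intro: order_trans[OF degree_smult_le]\<close>)+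
    then show "card X > degree r" using assms(2) by simp
    fix u assume u: "u \<in> X"
    have "poly (L x) u = (if x = u then 1 else 0)" if "x \<in> X" for x
    proof -
      have "poly (smult (inverse (x - y)) [:- y, 1:]) u = inverse (x - y) * (u - y)" for y
        by (simp add: algebra_simps)
      then show ?thesis
        using assms(1) u that
        by (auto simp: L_def poly_prod simp del: poly_smult poly_pCons intro!: prod.neutral left_inverse)
    qed
    then show "poly q u = poly r u"
      using u assms(1) by (simp add: r_def poly_sum if_distrib[of "(*) _"] sum.delta' cong: if_cong)
  qed
  then have "poly q t = poly r t" by simp
  then show ?thesis by (simp add: r_def L_def poly_sum)
qed

text \<open>
  The uniform degree bound \<open>N\<close> makes this elementary: in each coordinate the function is determined,
  through Lagrange's formula, by its values at the \<open>N + 1\<close> nodes \<open>1, \<dots>, N + 1\<close>. The nodes are nonzero,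
  so that the point obtained by moving one coordinate to a node again has no zero coordinate.
  The induction frees one more coordinate at a time, the others being frozen at those of \<open>y\<close>.
\<close>

lemma separately_polynomial_imp_polynomial:
  fixes h :: "complex^'n::finite \<Rightarrow> complex"
  assumes sep: "\<And>z i. (\<And>j. z $ j \<noteq> 0) \<Longrightarrow>
            \<exists>q. degree q \<le> N \<and> (\<forall>t. h (coordinate_update z i t) = poly q t)"
  shows "\<exists>p. polynomial_fun p \<and> (\<forall>z. (\<forall>j. z $ j \<noteq> 0) \<longrightarrow> h z = p z)"
proof -
  define X :: "complex set" where "X = (\<lambda>k. of_nat (Suc k)) ` {..N}"
  have X: "finite X" "card X = Suc N" "0 \<notin> X"
    by (auto simp: X_def card_image inj_on_def simp del: of_nat_Suc)
  define L where "L x = (\<Prod>y\<in>X - {x}. smult (inverse (x - y)) [:- y, 1:])" for x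
  have "\<exists>p. polynomial_fun p \<and>
          (\<forall>z. (\<forall>j. z $ j \<noteq> 0) \<and> (\<forall>j. j \<notin> S \<longrightarrow> z $ j = y $ j) \<longrightarrow> h z = p z)"
    for S :: "'n set" and y
    using finite[of S]
  proof (induction S arbitrary: y rule: finite_induct)
    case empty
    have "z = y" if "\<forall>j. z $ j = y $ j" for z using that by (simp add: vec_eq_iff)
    then show ?case by (intro exI[of _ "\<lambda>_. h y"]) (auto intro: polynomial_fun_const)
  next
    case (insert i S)
    obtain p where p: "\<And>x. polynomial_fun (p x)"
      "\<And>x z. \<forall>j. z $ j \<noteq> 0 \<Longrightarrow> \<forall>j. j \<notin> S \<longrightarrow> z $ j = coordinate_update y i x $ j \<Longrightarrow> h z = p x z"
      using insert.IH[of "coordinate_update y i _"] by metis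
    define P where "P z = (\<Sum>x\<in>X. p x (coordinate_update z i x) * poly (L x) (z $ i))" for z
    have "polynomial_fun P"
      unfolding P_def
      by (intro polynomial_fun_sum polynomial_fun_mult polynomial_fun_coordinate_update p
          polynomial_fun_poly polynomial_fun_coordinate)
    moreover have "h z = P z"
      if z: "\<forall>j. z $ j \<noteq> 0" "\<forall>j. j \<notin> insert i S \<longrightarrow> z $ j = y $ j" for z
    proof -
      obtain q where q: "degree q \<le> N" "\<And>t. h (coordinate_update z i t) = poly q t"
        using sep[of z i] z by blast
      have "h z = poly q (z $ i)" using q(2)[of "z $ i"] by simp
      also have "\<dots> = (\<Sum>x\<in>X. poly q x * poly (L x) (z $ i))"
        unfolding L_def by (rule lagrange_interpolation) (use X q in auto)
      also have "\<dots> = P z"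
        unfolding P_def
      proof (rule sum.cong)
        fix x assume "x \<in> X"
        then have "h (coordinate_update z i x) = p x (coordinate_update z i x)"
          by (intro p(2)) (use X z in auto)
        then show "poly q x * poly (L x) (z $ i)
            = p x (coordinate_update z i x) * poly (L x) (z $ i)"
          by (simp add: q(2))
      qed simp
      finally show ?thesis .
    qed
    ultimately show ?case by blast
  qed
  from this[of UNIV 0] show ?thesis by simp
qed

section \<open>From foliations to equivariant vector fields\<close>

lemma funpow_diag_map_nth: "((diag_map \<mu> ^^ m) z) $ i = \<mu> $ i ^ m * z $ i"
  by (induction m) (auto simp: diag_map_def mult_ac)

lemma linear_diag_map: "linear (diag_map \<mu>)"
  by (rule linearI) (auto simp: diag_map_def vec_eq_iff algebra_simps)

lemma tangent_action_eq: "tangent_action \<mu> (z, w) = (diag_map \<mu> z, diag_map \<mu> w)"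
proof -
  have "(diag_map \<mu> has_derivative diag_map \<mu>) (at z)"
    using linear_diag_map linear_imp_has_derivative by blast
  then have "frechet_derivative (diag_map \<mu>) (at z) = diag_map \<mu>"
    by (metis frechet_derivative_at)
  then show ?thesis by (simp add: tangent_action_def)
qed

lemma cyclic_orbit_shift:
  assumes "inj F"
  shows "cyclic_orbit F (F p) = cyclic_orbit F p"
proof (rule set_eqI)
  fix q
  have "(\<exists>n. q = (F ^^ n) (F p)) \<or> (\<exists>n. F p = (F ^^ n) q)
    \<longleftrightarrow> (\<exists>n. q = (F ^^ n) p) \<or> (\<exists>n. p = (F ^^ n) q)" (is "?A \<or> ?B \<longleftrightarrow> ?C \<or> ?D")
  proof
    assume "?A \<or> ?B"
    then show "?C \<or> ?D"
    proof (elim disjE exE)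
      fix n assume "q = (F ^^ n) (F p)"
      then have "q = (F ^^ Suc n) p" by (simp add: funpow_swap1)
      then show ?thesis by blast
    next
      fix n assume n: "F p = (F ^^ n) q"
      show ?thesis
      proof (cases n)
        case 0
        then have "q = (F ^^ Suc 0) p" using n by simp
        then show ?thesis by blast
      next
        case (Suc m)
        then show ?thesis using n assms by (auto dest: injD)
      qed
    qed
  next
    assume "?C \<or> ?D"
    then show "?A \<or> ?B"
    proof (elim disjE exE)
      fix n assume n: "q = (F ^^ n) p"
      show ?thesis
      proof (cases n)
        case 0
        then have "F p = (F ^^ Suc 0) q" using n by simp
        then show ?thesis by blast
      next
        case (Suc m)
        then show ?thesis using n by (auto simp: funpow_swap1)
      qed
    next
      fix n assume "p = (F ^^ n) q"
      then have "F p = (F ^^ Suc n) q" by simp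
      then show ?thesis by blast
    qed
  qed
  then show "q \<in> cyclic_orbit F (F p) \<longleftrightarrow> q \<in> cyclic_orbit F p"
    by (auto simp: cyclic_orbit_def)
qed

text \<open>
  If \<open>F\<close> covers a map \<open>G\<close> of the base for which \<open>z\<close> is not periodic, then an orbit of \<open>F\<close> cannot
  return to the fibre over \<open>z\<close>.
\<close>

lemma cyclic_orbit_fibre_inj:
  assumes fibre: "\<And>p. fst (F p) = G (fst p)"
    and free: "\<And>n. n > 0 \<Longrightarrow> (G ^^ n) z \<noteq> z"
    and eq: "cyclic_orbit F (z, w) = cyclic_orbit F (z, w')"
  shows "w = w'"
proof -
  have fst_pow: "fst ((F ^^ n) p) = (G ^^ n) (fst p)" for n p
    by (induction n) (auto simp: fibre)
  have zero: "n = 0" if "(z, u) = (F ^^ n) (z, v)" for n u v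
    using arg_cong[OF that, of fst] free[of n] by (auto simp: fst_pow)
  have "(z, w') \<in> cyclic_orbit F (z, w')"
    unfolding cyclic_orbit_def by (auto intro: exI[of _ 0])
  then have "(z, w') \<in> cyclic_orbit F (z, w)" by (simp add: eq)
  then obtain n where "(z, w') = (F ^^ n) (z, w) \<or> (z, w) = (F ^^ n) (z, w')"
    unfolding cyclic_orbit_def by blast
  then show ?thesis using zero[of w' n w] zero[of w n w'] by auto
qed

context
  fixes \<mu> :: "complex^'n::finite"
  assumes hopf: "hopf_data \<mu>"
begin

lemma multiplier_nonzero: "\<mu> $ i \<noteq> 0"
  using hopf unfolding hopf_data_def by force

lemma inj_diag_map: "inj (diag_map \<mu>)"
  by (rule injI) (use multiplier_nonzero in \<open>auto simp: diag_map_def vec_eq_iff\<close>)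

lemma diag_map_punctured: "z \<in> punctured_space \<Longrightarrow> diag_map \<mu> z \<in> punctured_space"
  using multiplier_nonzero by (auto simp: punctured_space_def diag_map_def vec_eq_iff)

text \<open>
  At a nonzero coordinate \<open>i\<close>, a fixed point of the \<open>m\<close>-th iterate gives \<open>\<mu>\<^sub>i\<^sup>m = 1\<close>, which is
  impossible as \<open>\<bar>\<mu>\<^sub>i\<bar> < 1\<close>.
\<close>

lemma diag_map_acts_freely:
  assumes "z \<in> punctured_space" "m > 0"
  shows "(diag_map \<mu> ^^ m) z \<noteq> z"
proof
  assume eq: "(diag_map \<mu> ^^ m) z = z"
  obtain i where "z $ i \<noteq> 0" using assms(1) by (auto simp: punctured_space_def vec_eq_iff)
  moreover have "\<mu> $ i ^ m * z $ i = z $ i"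
    using arg_cong[OF eq, of "\<lambda>x. x $ i"] by (simp add: funpow_diag_map_nth)
  ultimately have "cmod (\<mu> $ i) ^ m = 1" by (simp flip: norm_power)
  moreover have "cmod (\<mu> $ i) ^ m < 1"
    using hopf assms(2) by (intro power_less_one_iff[THEN iffD2]) (auto simp: hopf_data_def)
  ultimately show False by simp
qed

lemma tangent_class_inject:
  assumes "z \<in> punctured_space" "tangent_class \<mu> z w = tangent_class \<mu> z w'"
  shows "w = w'"
  by (rule cyclic_orbit_fibre_inj[of "tangent_action \<mu>" "diag_map \<mu>" z])
     (use assms diag_map_acts_freely in \<open>auto simp: tangent_action_def tangent_class_def\<close>)

lemma line_class_inject:
  assumes "z \<in> punctured_space" "line_class \<mu> b z v = line_class \<mu> b z v'"
  shows "v = v'"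
  by (rule cyclic_orbit_fibre_inj[of "line_action \<mu> b" "diag_map \<mu>" z])
     (use assms diag_map_acts_freely in \<open>auto simp: line_action_def line_class_def\<close>)

lemma tangent_class_shift: "tangent_class \<mu> (diag_map \<mu> z) (diag_map \<mu> w) = tangent_class \<mu> z w"
proof -
  have "inj (tangent_action \<mu>)"
    by (rule injI) (auto simp: tangent_action_eq dest: injD[OF inj_diag_map])
  from cyclic_orbit_shift[OF this, of "(z, w)"] show ?thesis
    by (simp add: tangent_class_def tangent_action_eq)
qed

lemma line_class_shift:
  assumes "b \<noteq> 0"
  shows "line_class \<mu> b (diag_map \<mu> z) (b * v) = line_class \<mu> b z v"
proof -
  have "inj (line_action \<mu> b)"
    by (rule injI) (use assms in \<open>auto simp: line_action_def dest: injD[OF inj_diag_map]\<close>)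
  from cyclic_orbit_shift[OF this, of "(z, v)"] show ?thesis
    by (simp add: line_class_def line_action_def)
qed

text \<open>
  The value \<open>g z\<close> is the representative over \<open>z\<close> of the image of the class of \<open>(z, 1)\<close>. Locally it
  is the holomorphic map \<open>A\<close> that defines the morphism. Since \<open>(z, 1)\<close> and \<open>(f z, b)\<close> represent the
  same class, \<open>b g(f z)\<close> and the differential of \<open>f\<close> applied to \<open>g z\<close> coincide. A zero of \<open>g\<close> would
  identify the classes of \<open>(z, 0)\<close> and \<open>(z, 1)\<close>.
\<close>

lemma foliation_induced_by_vector_field:
  assumes b: "b \<noteq> 0" and fol: "nonsingular_foliation \<mu> b \<F>"
  shows "\<exists>g. induced_by \<mu> b \<F> g"
proof -
  obtain \<phi> where mor: "line_tangent_morphism \<mu> b \<phi>" and inj: "inj_on \<phi> (line_bundle \<mu> b)"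
    and \<F>: "\<F> = \<phi> ` line_bundle \<mu> b"
    using fol unfolding nonsingular_foliation_def line_tangent_embedding_def by blast
  define g where "g z = (THE w. \<phi> (line_class \<mu> b z 1) = tangent_class \<mu> z w)" for z
  have local: "\<exists>U A. open U \<and> z0 \<in> U \<and> U \<subseteq> punctured_space \<and> holomorphic_map_on A U \<and>
      (\<forall>z\<in>U. A z = g z \<and> (\<forall>v. \<phi> (line_class \<mu> b z v) = tangent_class \<mu> z (v *s g z)))"
    if z0: "z0 \<in> punctured_space" for z0
  proof -
    obtain U A where U: "open U" "z0 \<in> U" "U \<subseteq> punctured_space" "holomorphic_map_on A U"
      "\<forall>z\<in>U. \<forall>v. \<phi> (line_class \<mu> b z v) = tangent_class \<mu> z (v *s A z)"
      using bspec[OF mor[unfolded line_tangent_morphism_def] z0] by (elim exE conjE)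
    have "A z = g z" if "z \<in> U" for z
      unfolding g_def
    proof (rule the_equality[symmetric])
      have \<phi>: "\<phi> (line_class \<mu> b z 1) = tangent_class \<mu> z (A z)"
        using U(5) that by (metis vector_smult_lid)
      show "\<phi> (line_class \<mu> b z 1) = tangent_class \<mu> z (A z)" by (fact \<phi>)
      fix w assume "\<phi> (line_class \<mu> b z 1) = tangent_class \<mu> z w"
      with \<phi> have "tangent_class \<mu> z w = tangent_class \<mu> z (A z)" by simp
      then show "w = A z" by (rule tangent_class_inject[rotated]) (use U(3) that in blast)
    qed
    with U show ?thesis by (intro exI[of _ U] exI[of _ A]) auto
  qed
  have \<phi>: "\<phi> (line_class \<mu> b z v) = tangent_class \<mu> z (v *s g z)" if "z \<in> punctured_space" for z v
    using local[OF that] by (elim exE conjE) (auto dest: bspec)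
  have "holomorphic_map_on g punctured_space"
    unfolding holomorphic_map_on_def
  proof
    fix z :: "complex^'n" assume z: "z \<in> punctured_space"
    from local[OF z] obtain U A where U: "open U" "z \<in> U" "holomorphic_map_on A U" "\<forall>z\<in>U. A z = g z"
      by (elim exE conjE) auto
    then obtain D where "(A has_derivative D) (at z)" "Vector_Spaces.linear (*s) (*s) D"
      unfolding holomorphic_map_on_def by blast
    moreover from this have "(g has_derivative D) (at z)"
      using has_derivative_transform_within_open[of A D z UNIV U g] U by simp
    ultimately show "\<exists>D. (g has_derivative D) (at z) \<and> Vector_Spaces.linear (*s) (*s) D"
      by blast
  qed
  moreover have "g z \<noteq> 0" if z: "z \<in> punctured_space" for z
  proof
    assume "g z = 0"
    then have "\<phi> (line_class \<mu> b z 0) = \<phi> (line_class \<mu> b z 1)" by (simp add: \<phi> z)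
    then have "line_class \<mu> b z 0 = line_class \<mu> b z 1"
      by (rule inj_onD[OF inj]) (use z in \<open>unfold line_bundle_def; blast\<close>)+
    from line_class_inject[OF z this] show False by simp
  qed
  moreover have "g (diag_map \<mu> z) $ k = \<mu> $ k * inverse b * g z $ k"
    if z: "z \<in> punctured_space" for z k
  proof -
    have "tangent_class \<mu> (diag_map \<mu> z) (b *s g (diag_map \<mu> z))
        = \<phi> (line_class \<mu> b (diag_map \<mu> z) (b * 1))"
      by (simp add: \<phi> diag_map_punctured z)
    also have "\<dots> = tangent_class \<mu> z (g z)"
      by (simp only: line_class_shift[OF b] \<phi>[OF z] vector_smult_lid)
    also have "\<dots> = tangent_class \<mu> (diag_map \<mu> z) (diag_map \<mu> (g z))"
      by (simp only: tangent_class_shift)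
    finally have "b *s g (diag_map \<mu> z) = diag_map \<mu> (g z)"
      by (rule tangent_class_inject[OF diag_map_punctured[OF z]])
    then have "b * g (diag_map \<mu> z) $ k = \<mu> $ k * g z $ k"
      by (simp add: vec_eq_iff diag_map_def)
    then show ?thesis using b by (simp add: field_simps)
  qed
  moreover have "\<F> = {tangent_class \<mu> z (c *s g z) | z c. z \<in> punctured_space}"
  proof -
    have "\<F> = {\<phi> (line_class \<mu> b z v) | z v. z \<in> punctured_space}"
      unfolding \<F> line_bundle_def by blast
    also have "\<dots> = {tangent_class \<mu> z (v *s g z) | z v. z \<in> punctured_space}"
      by (intro Collect_cong ex_cong1) (auto simp: \<phi>)
    finally show ?thesis .
  qed
  ultimately show ?thesis unfolding induced_by_def by blast
qed

end

lemma induced_by_cong: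
  assumes "induced_by \<mu> b \<F> g" and eq: "\<And>z. z \<in> punctured_space \<Longrightarrow> g' z = g z"
    and hopf: "hopf_data \<mu>"
  shows "induced_by \<mu> b \<F> g'"
proof -
  have "open (punctured_space :: (complex^'a) set)"
    by (auto simp: punctured_space_def)
  then have "holomorphic_map_on g' punctured_space"
    using assms(1) has_derivative_transform_within_open[of g _ _ UNIV punctured_space g'] eq
    unfolding induced_by_def holomorphic_map_on_def by (metis (no_types))
  moreover have "{tangent_class \<mu> z (c *s g' z) | z c. z \<in> punctured_space}
    = {tangent_class \<mu> z (c *s g z) | z c. z \<in> punctured_space}"
    by (intro Collect_cong ex_cong1) (auto simp: eq)
  ultimately show ?thesis
    using assms(1) diag_map_punctured[OF hopf] unfolding induced_by_def by (simp add: eq)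
qed

text \<open>
  A constant nonzero factor does not change the lines spanned by a vector field.
\<close>

lemma induced_by_rescale:
  assumes "induced_by \<mu> b \<F> (\<lambda>z. c *s u)" "c \<noteq> 0"
  shows "induced_by \<mu> b \<F> (\<lambda>z. u)"
proof -
  have "holomorphic_map_on (\<lambda>z. u) punctured_space"
    unfolding holomorphic_map_on_def
    by (intro ballI exI[of _ "\<lambda>_. 0"] conjI has_derivative_const) (unfold_locales; simp)
  moreover have "{tangent_class \<mu> z (t *s (c *s u)) | z t. z \<in> punctured_space}
    = {tangent_class \<mu> z (t *s u) | z t. z \<in> punctured_space}" (is "?A = ?B")
  proof
    show "?A \<subseteq> ?B" by (auto simp: vector_smult_assoc)
    show "?B \<subseteq> ?A"
    proof
      fix x assume "x \<in> ?B"
      then obtain z t where z: "z \<in> punctured_space" and "x = tangent_class \<mu> z (t *s u)"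
        by blast
      then have "x = tangent_class \<mu> z ((t / c) *s (c *s u))"
        using assms(2) by (simp add: vector_smult_assoc)
      with z show "x \<in> ?A" by blast
    qed
  qed
  ultimately show ?thesis
    using assms unfolding induced_by_def by auto
qed

section \<open>Equivariant holomorphic functions are polynomials\<close>

lemma monomial_fun_diag_map:
  "monomial_fun \<alpha> (diag_map \<mu> z) = monomial_fun \<alpha> \<mu> * monomial_fun \<alpha> z"
  by (simp add: monomial_fun_def diag_map_def power_mult_distrib prod.distrib)

lemma coordinate_update_has_derivative:
  fixes i :: "'n::finite"
  shows "(coordinate_update z i has_derivative axis i) (at t)"
proof -
  have "linear (axis i :: complex \<Rightarrow> complex^'n)"
    by (rule linearI) (auto simp: axis_def vec_eq_iff)
  then have "((\<lambda>s. coordinate_update z i 0 + axis i s) has_derivative axis i) (at t)"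
    by (auto intro!: derivative_eq_intros simp: linear_imp_has_derivative)
  moreover have "(\<lambda>s. coordinate_update z i 0 + axis i s) = coordinate_update z i"
    by (auto simp: vec_eq_iff axis_def fun_eq_iff)
  ultimately show ?thesis by simp
qed

lemma holomorphic_on_coordinate_line:
  fixes g :: "complex^'n \<Rightarrow> complex^'m"
  assumes "holomorphic_map_on g U" "\<And>t. coordinate_update z i t \<in> U"
  shows "(\<lambda>t. g (coordinate_update z i t) $ k) holomorphic_on UNIV"
  unfolding holomorphic_on_def
proof
  fix t
  obtain D where D: "(g has_derivative D) (at (coordinate_update z i t))"
    and lin: "Vector_Spaces.linear (*s) (*s) D"
    using assms unfolding holomorphic_map_on_def by blast
  have axis: "axis i s = s *s axis i 1" for s :: complex
    by (auto simp: vec_eq_iff axis_def)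
  have "(\<lambda>s. D (axis i s) $ k) = (*) (D (axis i 1) $ k)"
  proof
    show "D (axis i s) $ k = D (axis i 1) $ k * s" for s
      by (subst axis) (simp add: lin[unfolded Vector_Spaces.linear_iff])
  qed
  moreover have "((\<lambda>t. g (coordinate_update z i t) $ k) has_derivative (\<lambda>s. D (axis i s) $ k)) (at t)"
    using bounded_linear.has_derivative[OF bounded_linear_vec_nth
        has_derivative_compose[OF coordinate_update_has_derivative D]] by simp
  ultimately have "((\<lambda>t. g (coordinate_update z i t) $ k) has_field_derivative D (axis i 1) $ k) (at t)"
    by (simp only: has_field_derivative_def)
  then show "(\<lambda>t. g (coordinate_update z i t) $ k) field_differentiable at t within UNIV"
    unfolding field_differentiable_def by auto
qed

text \<open>
  Let \<open>M < 1\<close> be the largest and \<open>m\<close> the smallest \<open>\<bar>\<mu>\<^sub>i\<bar>\<close>. Iterating \<open>f\<close> brings every point outside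
  the unit ball into the compact shell \<open>m \<le> \<parallel>z\<parallel> \<le> 1\<close>. If \<open>M\<^sup>N < \<bar>\<nu>\<bar>\<close>, then a bound
  \<open>\<bar>h\<bar> \<le> B \<parallel>z\<parallel>\<^sup>N\<close> at \<open>f z\<close> implies the same bound at \<open>z\<close>, so it spreads from the shell outwards.
\<close>

lemma equivariant_polynomial_growth:
  fixes \<mu> :: "complex^'n::finite" and h :: "complex^'n \<Rightarrow> complex"
  assumes hopf: "hopf_data \<mu>" and cont: "continuous_on punctured_space h"
    and "\<nu> \<noteq> 0" and equiv: "\<And>z. z \<in> punctured_space \<Longrightarrow> h (diag_map \<mu> z) = \<nu> * h z"
  shows "\<exists>B N. \<forall>z. 1 \<le> norm z \<longrightarrow> cmod (h z) \<le> B * norm z ^ N"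
proof -
  define M where "M = Max (range (\<lambda>i. cmod (\<mu> $ i)))"
  define m where "m = Min (range (\<lambda>i. cmod (\<mu> $ i)))"
  have M: "cmod (\<mu> $ i) \<le> M" "m \<le> cmod (\<mu> $ i)" for i
    unfolding M_def m_def by auto
  have "M \<in> range (\<lambda>i. cmod (\<mu> $ i))" "m \<in> range (\<lambda>i. cmod (\<mu> $ i))"
    unfolding M_def m_def by (intro Max_in Min_in; simp)+
  then have M01: "0 < M" "M < 1" and m01: "0 < m" "m < 1"
    using hopf by (auto simp: hopf_data_def)
  have upper: "norm (diag_map \<mu> z) \<le> M * norm z" for z
  proof -
    have "norm (diag_map \<mu> z) \<le> norm (M *\<^sub>R z)"
      by (rule norm_le_componentwise_cart)
         (use M M01 in \<open>auto simp: diag_map_def norm_mult intro: mult_right_mono\<close>)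
    then show ?thesis using M01 by simp
  qed
  have lower: "m * norm z \<le> norm (diag_map \<mu> z)" for z
  proof -
    have "norm (m *\<^sub>R z) \<le> norm (diag_map \<mu> z)"
      by (rule norm_le_componentwise_cart)
         (use M m01 in \<open>auto simp: diag_map_def norm_mult intro: mult_right_mono\<close>)
    then show ?thesis using m01 by simp
  qed
  define K where "K = cball 0 1 - ball (0 :: complex^'n) m"
  have K: "z \<in> K \<longleftrightarrow> m \<le> norm z \<and> norm z \<le> 1" for z by (auto simp: K_def)
  have "compact K" unfolding K_def by (intro compact_diff) auto
  moreover have "continuous_on K h"
    by (rule continuous_on_subset[OF cont]) (use m01 in \<open>auto simp: K_def punctured_space_def\<close>)
  ultimately have "bounded (h ` K)" by (intro compact_imp_bounded compact_continuous_image)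
  then obtain C where C: "\<And>z. z \<in> K \<Longrightarrow> cmod (h z) \<le> C" "C > 0"
    unfolding bounded_pos by auto
  \<comment> \<open>With this \<open>N\<close>, the bound at \<open>f z\<close> passes to \<open>z\<close> without a larger constant.\<close>
  obtain N where N: "M ^ N < cmod \<nu>"
    using real_arch_pow_inv[of "cmod \<nu>" M] M01 \<open>\<nu> \<noteq> 0\<close> by auto
  define B where "B = C / m ^ N"
  have B: "0 < B" using C m01 by (simp add: B_def)
  \<comment> \<open>Induction on shells: outside the unit ball, \<open>f\<close> maps the shell
    \<open>m \<le> \<parallel>z\<parallel> \<le> M\<^bsup>-(k+1)\<^esup>\<close> into the shell \<open>m \<le> \<parallel>z\<parallel> \<le> M\<^bsup>-k\<^esup>\<close>.\<close>
  have annuli: "cmod (h z) \<le> B * norm z ^ N" if "m \<le> norm z" "norm z * M ^ k \<le> 1" for k z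
    using that
  proof (induction k arbitrary: z)
    case 0
    then have "cmod (h z) \<le> C" by (intro C) (auto simp: K)
    also have "C = B * m ^ N" using m01 by (simp add: B_def)
    also have "\<dots> \<le> B * norm z ^ N" using B 0 m01 by (auto intro!: mult_left_mono power_mono)
    finally show ?case .
  next
    case (Suc k)
    show ?case
    proof (cases "norm z \<le> 1")
      case True
      have "norm z * M ^ k \<le> 1"
        using True M01 power_le_one[of M k] by (intro mult_le_one) auto
      then show ?thesis by (rule Suc.IH[OF Suc.prems(1)])
    next
      case False
      then have "m * 1 \<le> m * norm z" using m01 by (intro mult_left_mono) auto
      with lower[of z] have "m \<le> norm (diag_map \<mu> z)" by linarith
      moreover have "norm (diag_map \<mu> z) * M ^ k \<le> 1"
      proof -
        have "norm (diag_map \<mu> z) * M ^ k \<le> (M * norm z) * M ^ k"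
          using M01 by (intro mult_right_mono upper) auto
        then show ?thesis using Suc.prems(2) by (simp add: mult_ac)
      qed
      ultimately have "cmod (h (diag_map \<mu> z)) \<le> B * norm (diag_map \<mu> z) ^ N" by (rule Suc.IH)
      also have "\<dots> \<le> B * (M * norm z) ^ N"
        using B upper[of z] by (intro mult_left_mono power_mono) auto
      also have "\<dots> = M ^ N * (B * norm z ^ N)" by (simp add: power_mult_distrib)
      also have "\<dots> \<le> cmod \<nu> * (B * norm z ^ N)"
        using N B by (intro mult_right_mono) auto
      finally have le: "cmod (h (diag_map \<mu> z)) \<le> cmod \<nu> * (B * norm z ^ N)" .
      have "cmod \<nu> * cmod (h z) \<le> cmod \<nu> * (B * norm z ^ N)"
      proof -
        have "z \<in> punctured_space" using False by (auto simp: punctured_space_def)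
        then show ?thesis using le by (simp add: equiv norm_mult)
      qed
      then show ?thesis using \<open>\<nu> \<noteq> 0\<close> by simp
    qed
  qed
  have "cmod (h z) \<le> B * norm z ^ N" if z: "1 \<le> norm z" for z
  proof -
    obtain k where "M ^ k < 1 / norm z"
      using real_arch_pow_inv[of "1 / norm z" M] M01 z by (metis less_le_trans zero_less_divide_1_iff zero_less_one)
    moreover have "norm z > 0" using z by linarith
    ultimately have "norm z * M ^ k \<le> 1" by (simp add: field_simps)
    with z m01 show ?thesis by (intro annuli) auto
  qed
  then show ?thesis by blast
qed

text \<open>
  Replacing the zero coordinates of \<open>z\<close> by \<open>1 / (m + 1)\<close> gives a sequence in \<open>(\<complex>\<^sup>*)\<^sup>n\<close> that tends to
  \<open>z\<close>.
\<close>

lemma eq_on_punctured_space_by_density: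
  fixes h p :: "complex^'n::finite \<Rightarrow> complex"
  assumes "continuous_on punctured_space h" "continuous_on punctured_space p"
    and eq: "\<And>z. \<forall>j. z $ j \<noteq> 0 \<Longrightarrow> h z = p z" and z: "z \<in> punctured_space"
  shows "h z = p z"
proof -
  define s where "s m = (\<chi> i. if z $ i = 0 then inverse (of_nat (Suc m)) else z $ i)" for m :: nat
  have *: "(\<lambda>m. inverse (of_nat (Suc m)) :: complex) \<longlonglongrightarrow> 0"
    using tendsto_of_real[OF LIMSEQ_inverse_real_of_nat, where 'a = complex] by simp
  have s: "s \<longlonglongrightarrow> z"
  proof (intro vec_tendstoI)
    show "(\<lambda>m. s m $ i) \<longlonglongrightarrow> z $ i" for i
      by (cases "z $ i = 0") (use * in \<open>auto simp: s_def simp del: of_nat_Suc\<close>)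
  qed
  have "open (punctured_space :: (complex^'n) set)" by (auto simp: punctured_space_def)
  then have "isCont h z" "isCont p z"
    using assms(1,2) z continuous_on_eq_continuous_at by blast+
  then have "(\<lambda>m. h (s m)) \<longlonglongrightarrow> h z" "(\<lambda>m. p (s m)) \<longlonglongrightarrow> p z"
    using s by (auto intro: isCont_tendsto_compose)
  moreover have "h (s m) = p (s m)" for m
    by (rule eq) (auto simp: s_def simp del: of_nat_Suc)
  ultimately show ?thesis using LIMSEQ_unique by auto
qed

text \<open>
  Unwanted monomials are removed one by one. If \<open>\<beta>\<close> has weight \<open>v \<noteq> \<nu>\<close>, then \<open>h \<circ> f - v h\<close> equals
  \<open>(\<nu> - v) h\<close>, whereas its expansion has lost the monomial \<open>\<beta>\<close> and gained no other one.
\<close>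

lemma eigenfunction_expansion:
  assumes "finite F" "finite E"
    and nonzero: "\<And>i. \<mu> $ i \<noteq> 0"
    and equiv: "\<And>z. \<forall>j. z $ j \<noteq> 0 \<Longrightarrow> h (diag_map \<mu> z) = \<nu> * h z"
    and E: "\<And>\<alpha>. \<alpha> \<in> E \<Longrightarrow> monomial_fun \<alpha> \<mu> = \<nu>"
    and F: "\<And>\<alpha>. \<alpha> \<in> F \<Longrightarrow> monomial_fun \<alpha> \<mu> \<noteq> \<nu>"
    and h: "\<And>z. \<forall>j. z $ j \<noteq> 0 \<Longrightarrow> h z = (\<Sum>\<alpha>\<in>E \<union> F. a \<alpha> * monomial_fun \<alpha> z)"
  shows "\<exists>a. \<forall>z. (\<forall>j. z $ j \<noteq> 0) \<longrightarrow> h z = (\<Sum>\<alpha>\<in>E. a \<alpha> * monomial_fun \<alpha> z)"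
  using assms(1) F h
proof (induction F arbitrary: a rule: finite_induct)
  case empty
  then show ?case by auto
next
  case (insert \<beta> F)
  define v where "v = monomial_fun \<beta> \<mu>"
  have v: "\<nu> - v \<noteq> 0" using insert.prems(1)[of \<beta>] by (auto simp: v_def)
  have \<beta>: "\<beta> \<notin> E \<union> F" using insert.hyps insert.prems(1)[of \<beta>] E by auto
  have h: "h z = (\<Sum>\<alpha>\<in>E \<union> F. (a \<alpha> * (monomial_fun \<alpha> \<mu> - v) / (\<nu> - v)) * monomial_fun \<alpha> z)"
    if z: "\<forall>j. z $ j \<noteq> 0" for z
  proof -
    have fz: "\<forall>j. diag_map \<mu> z $ j \<noteq> 0" using z nonzero by (simp add: diag_map_def)
    have "(\<nu> - v) * h z = h (diag_map \<mu> z) - v * h z"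
      using equiv[OF z] by (simp add: algebra_simps)
    also have "\<dots> = (\<Sum>\<alpha>\<in>insert \<beta> (E \<union> F). a \<alpha> * (monomial_fun \<alpha> \<mu> - v) * monomial_fun \<alpha> z)"
      using insert.prems(2)[OF z] insert.prems(2)[OF fz]
      by (simp add: sum_subtractf[symmetric] sum_distrib_left monomial_fun_diag_map algebra_simps
          del: sum.insert)
    also have "\<dots> = (\<Sum>\<alpha>\<in>E \<union> F. a \<alpha> * (monomial_fun \<alpha> \<mu> - v) * monomial_fun \<alpha> z)"
      using \<beta> assms(2) insert.hyps by (simp add: v_def)
    finally have "h z = (\<Sum>\<alpha>\<in>E \<union> F. a \<alpha> * (monomial_fun \<alpha> \<mu> - v) * monomial_fun \<alpha> z) / (\<nu> - v)"
      using v by (simp add: field_simps)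
    then show ?thesis by (simp add: sum_divide_distrib)
  qed
  show ?case by (rule insert.IH[OF insert.prems(1) h]) auto
qed

lemma norm_axis: "norm (axis i t :: complex^'n::finite) = cmod t"
  by (simp add: norm_vec_def L2_set_def axis_def if_distrib[of norm]
      if_distrib[of "\<lambda>x::real. x ^ 2"] cong: if_cong)

text \<open>
  The dimension is at least 2, so some coordinate other than the \<open>i\<close>-th stays nonzero along the line,
  which therefore avoids the origin. The restriction to it is an entire function of polynomial growth,
  and Liouville's theorem applies.
\<close>

lemma polynomial_coordinate_line:
  fixes g :: "complex^'n::finite \<Rightarrow> complex^'m"
  assumes card: "CARD('n) \<ge> 2" and hol: "holomorphic_map_on g punctured_space"
    and growth: "\<And>z. 1 \<le> norm z \<Longrightarrow> cmod (g z $ k) \<le> B * norm z ^ N"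
    and z: "\<And>j. z $ j \<noteq> 0"
  shows "\<exists>q. degree q \<le> N \<and> (\<forall>t. g (coordinate_update z i t) $ k = poly q t)"
proof -
  have "\<exists>j. j \<noteq> i"
  proof (rule ccontr)
    assume "\<not> ?thesis"
    then have "UNIV = {i}" by auto
    then have "CARD('n) = card {i}" by (rule arg_cong)
    with card show False by simp
  qed
  then obtain j where j: "j \<noteq> i" ..
  let ?line = "coordinate_update z i"
  have "?line t \<in> punctured_space" for t
  proof -
    have "?line t $ j \<noteq> 0" using z[of j] j by simp
    then show ?thesis unfolding punctured_space_def by (metis ComplI singletonD zero_index)
  qed
  then have hol_line: "(\<lambda>t. g (?line t) $ k) holomorphic_on UNIV"
    by (intro holomorphic_on_coordinate_line[OF hol])
  define R where "R = norm (?line 0)"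
  have line: "norm (?line t) \<le> R + cmod t" "cmod t \<le> norm (?line t)" for t
  proof -
    have "?line t = ?line 0 + axis i t" by (auto simp: vec_eq_iff axis_def)
    then show "norm (?line t) \<le> R + cmod t"
      using norm_triangle_ineq[of "?line 0" "axis i t"]
      by (simp add: R_def norm_axis)
    show "cmod t \<le> norm (?line t)" using Finite_Cartesian_Product.norm_nth_le[of "?line t" i] by simp
  qed
  have bound: "cmod (g (?line t) $ k) \<le> (\<bar>B\<bar> * 2 ^ N) * cmod t ^ N" if t: "max 1 R \<le> cmod t" for t
  proof -
    have "cmod (g (?line t) $ k) \<le> B * norm (?line t) ^ N"
      using line(2)[of t] t by (intro growth) auto
    also have "\<dots> \<le> \<bar>B\<bar> * (2 * cmod t) ^ N"
      using line(1)[of t] t by (intro mult_mono power_mono) auto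
    finally show ?thesis by (simp add: power_mult_distrib mult_ac)
  qed
  define c where "c l = (deriv ^^ l) (\<lambda>t. g (?line t) $ k) 0 / fact l" for l
  have "g (?line t) $ k = poly (\<Sum>l\<le>N. monom (c l) l) t" for t
    using Liouville_polynomial[OF hol_line bound, where \<xi> = t and A = "max 1 R"]
    by (simp add: c_def poly_sum poly_monom)
  moreover have "degree (\<Sum>l\<le>N. monom (c l) l) \<le> N"
    by (intro degree_sum_le) (auto intro: order_trans[OF degree_monom_le])
  ultimately show ?thesis by blast
qed

text \<open>
  Polynomial growth, the restriction to coordinate lines and interpolation give a polynomial on
  \<open>(\<complex>\<^sup>*)\<^sup>n\<close>. The monomials of the wrong weight are then removed, and density extends the formula to
  all of \<open>W\<close>.
\<close>

lemma equivariant_component_expansion: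
  fixes \<mu> :: "complex^'n::finite" and g :: "complex^'n \<Rightarrow> complex^'m"
  assumes hopf: "hopf_data \<mu>" and hol: "holomorphic_map_on g punctured_space"
    and "\<nu> \<noteq> 0" and equiv: "\<And>z. z \<in> punctured_space \<Longrightarrow> g (diag_map \<mu> z) $ k = \<nu> * g z $ k"
  shows "\<exists>E a. finite E \<and> (\<forall>\<alpha>\<in>E. monomial_fun \<alpha> \<mu> = \<nu>) \<and>
           (\<forall>z\<in>punctured_space. g z $ k = (\<Sum>\<alpha>\<in>E. a \<alpha> * monomial_fun \<alpha> z))"
proof -
  have "isCont g z" if "z \<in> punctured_space" for z
    using bspec[OF hol[unfolded holomorphic_map_on_def] that]
    by (elim exE conjE) (rule has_derivative_continuous)
  then have cont: "continuous_on punctured_space (\<lambda>z. g z $ k)"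
    by (intro continuous_at_imp_continuous_on ballI continuous_component) auto
  obtain B N where "\<And>z. 1 \<le> norm z \<Longrightarrow> cmod (g z $ k) \<le> B * norm z ^ N"
    using equivariant_polynomial_growth[OF hopf cont \<open>\<nu> \<noteq> 0\<close> equiv] by auto
  then obtain p where "polynomial_fun p" and p: "\<And>z. \<forall>j. z $ j \<noteq> 0 \<Longrightarrow> g z $ k = p z"
    using separately_polynomial_imp_polynomial[of N "\<lambda>z. g z $ k"]
      polynomial_coordinate_line[OF _ hol, of k B N] hopf
    unfolding hopf_data_def by metis
  then obtain F c where F: "finite F" "\<And>z. p z = (\<Sum>\<alpha>\<in>F. c \<alpha> * monomial_fun \<alpha> z)"
    unfolding polynomial_fun_def by blast
  define E where "E = {\<alpha>\<in>F. monomial_fun \<alpha> \<mu> = \<nu>}"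
  have nz: "z \<in> punctured_space" if "\<forall>j. z $ j \<noteq> 0" for z :: "complex^'n"
    using that by (auto simp: punctured_space_def)
  have "\<exists>a. \<forall>z. (\<forall>j. z $ j \<noteq> 0) \<longrightarrow> g z $ k = (\<Sum>\<alpha>\<in>E. a \<alpha> * monomial_fun \<alpha> z)"
  proof (rule eigenfunction_expansion[of "F - E" E \<mu> "\<lambda>z. g z $ k" \<nu> c])
    show "\<mu> $ i \<noteq> 0" for i using multiplier_nonzero[OF hopf] .
    show "g z $ k = (\<Sum>\<alpha>\<in>E \<union> (F - E). c \<alpha> * monomial_fun \<alpha> z)" if "\<forall>j. z $ j \<noteq> 0" for z
      using p[OF that] F(2) by (simp add: E_def Un_absorb1)
  qed (use F(1) in \<open>auto simp: E_def intro!: equiv nz\<close>)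
  then obtain a where a: "\<And>z. \<forall>j. z $ j \<noteq> 0 \<Longrightarrow> g z $ k = (\<Sum>\<alpha>\<in>E. a \<alpha> * monomial_fun \<alpha> z)"
    by blast
  have "g z $ k = (\<Sum>\<alpha>\<in>E. a \<alpha> * monomial_fun \<alpha> z)" if "z \<in> punctured_space" for z
    by (rule eq_on_punctured_space_by_density[OF cont _ _ that])
       (auto simp: a monomial_fun_def intro!: continuous_intros)
  moreover have "finite E" using F(1) by (simp add: E_def)
  ultimately show ?thesis by (intro exI[of _ E] exI[of _ a]) (auto simp: E_def)
qed

lemma induced_by_expansion:
  assumes hopf: "hopf_data \<mu>" and b: "b \<noteq> 0" and g: "induced_by \<mu> b \<F> g"
  shows "\<exists>E a. (\<forall>k. \<forall>\<alpha>\<in>E k. monomial_fun \<alpha> \<mu> * b = \<mu> $ k) \<and>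
    (\<forall>k. \<forall>z\<in>punctured_space. g z $ k = (\<Sum>\<alpha>\<in>E k. a k \<alpha> * monomial_fun \<alpha> z))"
proof -
  have "\<exists>E a. finite E \<and> (\<forall>\<alpha>\<in>E. monomial_fun \<alpha> \<mu> = \<mu> $ k * inverse b) \<and>
      (\<forall>z\<in>punctured_space. g z $ k = (\<Sum>\<alpha>\<in>E. a \<alpha> * monomial_fun \<alpha> z))" for k
    by (rule equivariant_component_expansion[OF hopf])
       (use g b multiplier_nonzero[OF hopf] in \<open>auto simp: induced_by_def\<close>)
  then obtain E a where E:
      "\<And>k. \<forall>\<alpha>\<in>E k. monomial_fun \<alpha> \<mu> = \<mu> $ k * inverse b"
      "\<And>k. \<forall>z\<in>punctured_space. g z $ k = (\<Sum>\<alpha>\<in>E k. a k \<alpha> * monomial_fun \<alpha> z)"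
    by metis
  show ?thesis
    by (rule exI[of _ E], rule exI[of _ a]) (use E b in \<open>auto simp: field_simps\<close>)
qed

text \<open>
  At the \<open>i\<close>-th unit vector all monomials other than the powers of \<open>z\<^sub>i\<close> vanish, but \<open>g\<close> does not.
\<close>

lemma axis_exponent:
  assumes g: "induced_by \<mu> b \<F> g"
    and E: "\<forall>k. \<forall>z\<in>punctured_space. g z $ k = (\<Sum>\<alpha>\<in>E k. a k \<alpha> * monomial_fun \<alpha> z)"
  shows "\<exists>k. \<exists>\<alpha>\<in>E k. \<forall>j. j \<noteq> i \<longrightarrow> \<alpha> j = 0"
proof -
  define e :: "complex^'a" where "e = axis i 1"
  have e: "e \<in> punctured_space" by (simp add: e_def punctured_space_def axis_eq_0_iff)
  then have "g e \<noteq> 0" using g unfolding induced_by_def by blast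
  then obtain k where "g e $ k \<noteq> 0" by (auto simp: vec_eq_iff)
  then have "(\<Sum>\<alpha>\<in>E k. a k \<alpha> * monomial_fun \<alpha> e) \<noteq> 0" using E e by simp
  then obtain \<alpha> where \<alpha>: "\<alpha> \<in> E k" "a k \<alpha> * monomial_fun \<alpha> e \<noteq> 0"
    by (rule sum.not_neutral_contains_not_neutral)
  have "\<alpha> j = 0" if "j \<noteq> i" for j
  proof (rule ccontr)
    assume "\<alpha> j \<noteq> 0"
    then have "e $ j ^ \<alpha> j = 0" using that by (simp add: e_def axis_def)
    then have "monomial_fun \<alpha> e = 0" unfolding monomial_fun_def by (intro prod_zero) auto
    with \<alpha>(2) show False by simp
  qed
  with \<alpha>(1) show ?thesis by blast
qed

lemma axis_multiplier:
  assumes hopf: "hopf_data \<mu>" and b: "b \<noteq> 0" and g: "induced_by \<mu> b \<F> g"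
  shows "\<exists>k m. \<mu> $ i ^ m * b = \<mu> $ k"
proof -
  obtain E a where E: "\<forall>k. \<forall>\<alpha>\<in>E k. monomial_fun \<alpha> \<mu> * b = \<mu> $ k"
    "\<forall>k. \<forall>z\<in>punctured_space. g z $ k = (\<Sum>\<alpha>\<in>E k. a k \<alpha> * monomial_fun \<alpha> z)"
    using induced_by_expansion[OF hopf b g] by blast
  note axis = axis_exponent[OF g E(2)] and E = E[rule_format]
  obtain k \<alpha> where \<alpha>: "\<alpha> \<in> E k" "\<forall>j. j \<noteq> i \<longrightarrow> \<alpha> j = 0"
    using axis by blast
  have "\<alpha> = (\<lambda>j. \<alpha> i * unit_exponent i j)"
    using \<alpha>(2) by (auto simp: unit_exponent_def)
  then have "monomial_fun \<alpha> \<mu> = \<mu> $ i ^ \<alpha> i" by (metis monomial_fun_unit)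
  with E(1)[OF \<alpha>(1)] show ?thesis by metis
qed

section \<open>Multiplicative relations between the multipliers\<close>

text \<open>
  Cancelling common powers turns an equality of power products into a relation between disjoint sets
  of indices, with exponents \<open>\<bar>\<rho> s - \<sigma> s\<bar>\<close>; such a relation is trivial by hypothesis.
\<close>

lemma power_products_unique:
  assumes rel: "no_nontrivial_relation \<mu> S" and nz: "\<And>i. \<mu> $ i \<noteq> 0"
    and eq: "(\<Prod>s\<in>S. \<mu> $ s ^ \<rho> s) = (\<Prod>s\<in>S. \<mu> $ s ^ \<sigma> s)" and s: "s \<in> S"
  shows "\<rho> s = \<sigma> s"
proof -
  define A where "A = {s\<in>S. \<sigma> s \<le> \<rho> s}"
  define B where "B = {s\<in>S. \<rho> s < \<sigma> s}"
  define \<tau> where "\<tau> s = (\<rho> s - \<sigma> s) + (\<sigma> s - \<rho> s)" for s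
  have AB: "A \<inter> B = {}" "A \<union> B = S" by (auto simp: A_def B_def)
  have split: "(\<Prod>s\<in>S. f s) = (\<Prod>s\<in>A. f s) * (\<Prod>s\<in>B. f s)" for f :: "_ \<Rightarrow> complex"
    unfolding AB(2)[symmetric] by (rule prod.union_disjoint) (use AB in auto)
  have A: "(\<Prod>s\<in>A. \<mu> $ s ^ \<rho> s) = (\<Prod>s\<in>A. \<mu> $ s ^ \<sigma> s) * (\<Prod>s\<in>A. \<mu> $ s ^ \<tau> s)"
    unfolding prod.distrib[symmetric] power_add[symmetric]
    by (rule prod.cong) (auto simp: A_def \<tau>_def)
  have B: "(\<Prod>s\<in>B. \<mu> $ s ^ \<sigma> s) = (\<Prod>s\<in>B. \<mu> $ s ^ \<rho> s) * (\<Prod>s\<in>B. \<mu> $ s ^ \<tau> s)"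
    unfolding prod.distrib[symmetric] power_add[symmetric]
    by (rule prod.cong) (auto simp: B_def \<tau>_def)
  have "(\<Prod>s\<in>A. \<mu> $ s ^ \<tau> s) = (\<Prod>s\<in>B. \<mu> $ s ^ \<tau> s)"
    using eq unfolding split A B by (simp add: nz)
  with rel AB have "\<forall>s\<in>S. \<tau> s = 0"
    unfolding no_nontrivial_relation_def by blast
  with s show ?thesis by (auto simp: \<tau>_def)
qed

text \<open>
  The map \<open>\<kappa>\<close> sends each index to the representative of its class, on which the multiplier is
  constant, and \<open>S\<close> contains the representatives. Generic manifolds have \<open>\<kappa> = id\<close>; for intermediary
  ones \<open>\<kappa>\<close> collapses the first \<open>r\<close> indices to the first one.
\<close>

context
  fixes \<mu> :: "complex^'n::finite" and \<kappa> :: "'n \<Rightarrow> 'n" and S :: "'n set"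
  assumes hopf: "hopf_data \<mu>"
    and rep: "\<And>i. \<kappa> i \<in> S" "\<And>i. \<mu> $ \<kappa> i = \<mu> $ i"
    and rel: "no_nontrivial_relation \<mu> S"
begin

text \<open>
  Grouping the factors of \<open>\<mu>\<^sup>\<alpha>\<close> by classes turns it into a power product of the representatives, in
  which the exponent of a representative is the degree of \<open>\<alpha>\<close> in the variables of its class.
\<close>

lemma class_degree_unique:
  assumes "monomial_fun \<alpha> \<mu> = monomial_fun \<beta> \<mu>"
  shows "(\<Sum>i | \<kappa> i = \<kappa> k. \<alpha> i) = (\<Sum>i | \<kappa> i = \<kappa> k. \<beta> i)"
proof -
  have "monomial_fun \<alpha> \<mu> = (\<Prod>s\<in>S. \<mu> $ s ^ (\<Sum>i | \<kappa> i = s. \<alpha> i))" for \<alpha>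
  proof -
    have "(\<Prod>s\<in>S. \<mu> $ s ^ (\<Sum>i | \<kappa> i = s. \<alpha> i)) = (\<Prod>s\<in>S. \<Prod>i | i \<in> UNIV \<and> \<kappa> i = s. \<mu> $ i ^ \<alpha> i)"
      unfolding power_sum by (intro prod.cong) (auto simp: rep(2))
    also have "\<dots> = (\<Prod>i\<in>UNIV. \<mu> $ i ^ \<alpha> i)"
      by (rule prod.group) (use rep(1) in auto)
    finally show ?thesis by (simp add: monomial_fun_def)
  qed
  with assms show ?thesis
    by (intro power_products_unique[OF rel multiplier_nonzero[OF hopf]]) (auto simp: rep(1))
qed

lemma class_degree_unit:
  "(\<Sum>i | \<kappa> i = \<kappa> k. m * unit_exponent j i) = (if \<kappa> j = \<kappa> k then m else 0)"
  by (simp add: unit_exponent_def if_distrib[of "(*) m"] sum.delta' cong: if_cong)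

text \<open>
  The monomial has degree 1 in the variables of the class of \<open>k\<close> and degree 0 in those of all other
  classes.
\<close>

lemma linear_exponent:
  assumes "monomial_fun \<alpha> \<mu> = \<mu> $ k"
  obtains i where "\<kappa> i = \<kappa> k" "\<alpha> = unit_exponent i"
proof -
  have deg: "(\<Sum>i | \<kappa> i = \<kappa> l. \<alpha> i) = (if \<kappa> k = \<kappa> l then 1 else 0)" for l
    using class_degree_unique[of \<alpha> "\<lambda>x. 1 * unit_exponent k x" l] assms
    by (simp only: class_degree_unit monomial_fun_unit power_one_right)
  have "(\<Sum>i | \<kappa> i = \<kappa> k. \<alpha> i) = 1" using deg[of k] by simp
  then have "\<exists>i\<in>{i. \<kappa> i = \<kappa> k}. \<alpha> i = 1 \<and> (\<forall>j\<in>{i. \<kappa> i = \<kappa> k}. i \<noteq> j \<longrightarrow> \<alpha> j = 0)"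
    by (subst (asm) sum_eq_1_iff) auto
  then obtain i where i: "\<kappa> i = \<kappa> k" "\<alpha> i = 1" "\<forall>j. \<kappa> j = \<kappa> k \<longrightarrow> j \<noteq> i \<longrightarrow> \<alpha> j = 0"
    by auto
  have "\<alpha> j = 0" if "\<kappa> j \<noteq> \<kappa> k" for j
  proof -
    have "(\<Sum>i | \<kappa> i = \<kappa> j. \<alpha> i) = 0" using deg[of j] that by auto
    then show ?thesis by simp
  qed
  with i have "\<alpha> = unit_exponent i" by (auto simp: unit_exponent_def fun_eq_iff)
  with i(1) show ?thesis by (rule that)
qed

text \<open>
  Multiplied by \<open>z\<^sub>l\<close>, the monomial becomes a single variable \<open>z\<^sub>i\<close> of the class of \<open>k\<close>;
  hence \<open>i = l\<close> and nothing is left of \<open>\<alpha>\<close>.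
\<close>

lemma constant_exponent:
  assumes "monomial_fun \<alpha> \<mu> * \<mu> $ l = \<mu> $ k"
  shows "\<alpha> = (\<lambda>_. 0)" "\<kappa> k = \<kappa> l"
proof -
  have "monomial_fun (\<lambda>x. \<alpha> x + unit_exponent l x) \<mu> = \<mu> $ k"
    using assms by (simp add: monomial_fun_add)
  then obtain i where i: "\<kappa> i = \<kappa> k" "(\<lambda>x. \<alpha> x + unit_exponent l x) = unit_exponent i"
    by (rule linear_exponent)
  have eq: "\<alpha> x + unit_exponent l x = unit_exponent i x" for x
    using fun_cong[OF i(2), of x] .
  have "i = l" using eq[of l] by (auto simp: unit_exponent_def split: if_splits)
  with i show "\<kappa> k = \<kappa> l" by simp
  show "\<alpha> = (\<lambda>_. 0)" using eq \<open>i = l\<close> by auto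
qed

text \<open>
  The \<open>i\<close>-th and the \<open>j\<close>-th axis give \<open>\<mu>\<^sub>i\<^sup>m b = \<mu>\<^sub>k\<close> and \<open>\<mu>\<^sub>j\<^bsup>m'\<^esup> b = \<mu>\<^sub>k\<^sub>'\<close>.
  Eliminating \<open>b\<close> and comparing degrees in the class of \<open>i\<close> shows that either \<open>m = 0\<close>, and then
  \<open>b = \<mu>\<^sub>k\<close>, or \<open>m = 1\<close> and \<open>k\<close> lies in the class of \<open>i\<close>, and then \<open>b = 1\<close>.
\<close>

lemma twist_is_one_or_multiplier:
  assumes b: "b \<noteq> 0" and g: "induced_by \<mu> b \<F> g" and "\<kappa> i \<noteq> \<kappa> j"
  shows "b = 1 \<or> (\<exists>k. b = \<mu> $ k)"
proof -
  obtain k m k' m' where k: "\<mu> $ i ^ m * b = \<mu> $ k" and k': "\<mu> $ j ^ m' * b = \<mu> $ k'"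
    using axis_multiplier[OF hopf b g] by metis
  have "\<mu> $ i ^ m * \<mu> $ k' = \<mu> $ j ^ m' * \<mu> $ k"
    by (simp flip: k k')
  then have "monomial_fun (\<lambda>x. m * unit_exponent i x + 1 * unit_exponent k' x) \<mu>
      = monomial_fun (\<lambda>x. m' * unit_exponent j x + 1 * unit_exponent k x) \<mu>"
    by (simp only: monomial_fun_add monomial_fun_unit power_one_right)
  from class_degree_unique[OF this, of i]
  have "m + (if \<kappa> k' = \<kappa> i then 1 else 0) = (if \<kappa> k = \<kappa> i then 1 else 0)"
    using \<open>\<kappa> i \<noteq> \<kappa> j\<close> by (simp only: sum.distrib class_degree_unit) auto
  then consider "m = 0" | "m = 1" "\<kappa> k = \<kappa> i" by (auto split: if_splits)
  then show ?thesis
  proof cases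
    case 1
    then show ?thesis using k by auto
  next
    case 2
    then have "\<mu> $ k = \<mu> $ i" using rep(2) by metis
    then have "b = 1" using k 2 multiplier_nonzero[OF hopf, of i] by simp
    then show ?thesis ..
  qed
qed

lemma linear_vector_field:
  assumes g: "induced_by \<mu> 1 \<F> g"
  shows "\<exists>c. \<forall>k. \<forall>z\<in>punctured_space. g z $ k = (\<Sum>i | \<kappa> i = \<kappa> k. c k i * z $ i)"
proof -
  obtain E a where E: "\<forall>k. \<forall>\<alpha>\<in>E k. monomial_fun \<alpha> \<mu> * 1 = \<mu> $ k"
    "\<forall>k. \<forall>z\<in>punctured_space. g z $ k = (\<Sum>\<alpha>\<in>E k. a k \<alpha> * monomial_fun \<alpha> z)"
    using induced_by_expansion[OF hopf one_neq_zero g] by blast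
  note E = E[rule_format]
  have sub: "E k \<subseteq> unit_exponent ` {i. \<kappa> i = \<kappa> k}" for k
  proof
    fix \<alpha> assume "\<alpha> \<in> E k"
    then have "monomial_fun \<alpha> \<mu> = \<mu> $ k" using E(1) by simp
    then obtain i where "\<kappa> i = \<kappa> k" "\<alpha> = unit_exponent i" by (rule linear_exponent)
    then show "\<alpha> \<in> unit_exponent ` {i. \<kappa> i = \<kappa> k}" by simp
  qed
  have inj: "inj_on unit_exponent I" for I :: "'n set"
    by (rule inj_onI) (auto simp: unit_exponent_def fun_eq_iff split: if_splits)
  define c where "c k i = (if unit_exponent i \<in> E k then a k (unit_exponent i) else 0)" for k i
  have "g z $ k = (\<Sum>i | \<kappa> i = \<kappa> k. c k i * z $ i)" if z: "z \<in> punctured_space" for k z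
  proof -
    have "g z $ k = (\<Sum>\<alpha>\<in>unit_exponent ` {i. \<kappa> i = \<kappa> k}.
        (if \<alpha> \<in> E k then a k \<alpha> else 0) * monomial_fun \<alpha> z)"
      unfolding E(2)[OF z] by (rule sum.mono_neutral_cong_left) (use sub[of k] in auto)
    also have "\<dots> = (\<Sum>i | \<kappa> i = \<kappa> k. c k i * z $ i)"
      by (subst sum.reindex[OF inj]) (simp add: c_def)
    finally show ?thesis .
  qed
  then show ?thesis by blast
qed

lemma constant_vector_field:
  assumes g: "induced_by \<mu> (\<mu> $ l) \<F> g"
  shows "\<exists>c. \<forall>k. \<forall>z\<in>punctured_space. g z $ k = (if \<kappa> k = \<kappa> l then c k else 0)"
proof -
  obtain E a where E: "\<forall>k. \<forall>\<alpha>\<in>E k. monomial_fun \<alpha> \<mu> * \<mu> $ l = \<mu> $ k"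
    "\<forall>k. \<forall>z\<in>punctured_space. g z $ k = (\<Sum>\<alpha>\<in>E k. a k \<alpha> * monomial_fun \<alpha> z)"
    using induced_by_expansion[OF hopf multiplier_nonzero[OF hopf] g] by blast
  note E = E[rule_format]
  have "g z $ k = (if \<kappa> k = \<kappa> l then \<Sum>\<alpha>\<in>E k. a k \<alpha> else 0)"
    if z: "z \<in> punctured_space" for k z
  proof (cases "\<kappa> k = \<kappa> l")
    case True
    have "a k \<alpha> * monomial_fun \<alpha> z = a k \<alpha>" if "\<alpha> \<in> E k" for \<alpha>
      using constant_exponent(1)[OF E(1)[OF that]] by simp
    then show ?thesis using True by (auto simp: E(2)[OF z] intro!: sum.cong)
  next
    case False
    then have "E k = {}" using constant_exponent(2)[OF E(1)] by auto
    then show ?thesis using False by (simp add: E(2)[OF z])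
  qed
  then show ?thesis by (intro exI[of _ "\<lambda>k. \<Sum>\<alpha>\<in>E k. a k \<alpha>"]) auto
qed

end

section \<open>Classical Hopf manifolds\<close>

lemma finite_exponents_of_degree:
  "finite {\<alpha> :: 'n::finite \<Rightarrow> nat. (\<Sum>i\<in>UNIV. \<alpha> i) = d}"
proof (rule finite_subset)
  have "\<alpha> i \<le> (\<Sum>i\<in>UNIV. \<alpha> i)" for \<alpha> :: "'n \<Rightarrow> nat" and i
    by (rule member_le_sum) auto
  then show "{\<alpha> :: 'n \<Rightarrow> nat. (\<Sum>i\<in>UNIV. \<alpha> i) = d} \<subseteq> PiE UNIV (\<lambda>_. {..d})"
    by auto
qed (intro finite_PiE; simp)

text \<open>
  The weight of a monomial is \<open>\<nu>\<close> to the power of its degree, and these powers are distinct, as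
  \<open>0 < \<bar>\<nu>\<bar> < 1\<close>. So all monomials of all components have one degree \<open>d\<close>, and \<open>\<nu>\<^sup>d b = \<nu>\<close>, that is,
  \<open>b = \<nu>\<^bsup>1 - d\<^esup>\<close> and \<open>m = d - 1\<close>. The polynomial field agrees with \<open>g\<close> on \<open>W\<close>, where it has no
  zero; its value at the origin is 0 unless \<open>d = 0\<close>, when the field is a nonzero constant.
\<close>

lemma classical_foliation:
  assumes cl: "classical_hopf \<mu> \<nu>" and b: "b \<noteq> 0" and g: "induced_by \<mu> b \<F> g"
  shows "\<exists>m::int. m \<ge> -1 \<and> b = \<nu> powi (- m) \<and>
     (\<exists>g. (\<forall>i. homogeneous_polynomial (nat (m + 1)) (\<lambda>z. g z $ i)) \<and>
          {z. \<forall>i. g z $ i = 0} = (if m = -1 then {} else {0}) \<and> induced_by \<mu> b \<F> g)"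
proof -
  have hopf: "hopf_data \<mu>" and \<mu>: "\<And>i. \<mu> $ i = \<nu>" using cl by (auto simp: classical_hopf_def)
  have \<nu>: "0 < cmod \<nu>" "cmod \<nu> < 1" using hopf \<mu> by (auto simp: hopf_data_def)
  have weight: "monomial_fun \<alpha> \<mu> = \<nu> ^ (\<Sum>i\<in>UNIV. \<alpha> i)" for \<alpha>
    by (simp add: monomial_fun_def \<mu> power_sum)
  obtain E a where E: "\<forall>k. \<forall>\<alpha>\<in>E k. monomial_fun \<alpha> \<mu> * b = \<mu> $ k"
    "\<forall>k. \<forall>z\<in>punctured_space. g z $ k = (\<Sum>\<alpha>\<in>E k. a k \<alpha> * monomial_fun \<alpha> z)"
    using induced_by_expansion[OF hopf b g] by blast
  note axis = axis_exponent[OF g E(2)] and E = E[rule_format]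
  obtain k0 \<alpha>0 where \<alpha>0: "\<alpha>0 \<in> E k0" using axis[of undefined] by blast
  define d where "d = (\<Sum>i\<in>UNIV. \<alpha>0 i)"
  have d: "\<nu> ^ d * b = \<nu>" using E(1)[OF \<alpha>0] by (simp add: weight d_def \<mu>)
  have deg: "(\<Sum>i\<in>UNIV. \<alpha> i) = d" if "\<alpha> \<in> E k" for k \<alpha>
  proof -
    have "\<nu> ^ (\<Sum>i\<in>UNIV. \<alpha> i) * b = \<nu> ^ d * b" using E(1)[OF that] d by (simp add: weight \<mu>)
    then have "cmod \<nu> ^ (\<Sum>i\<in>UNIV. \<alpha> i) = cmod \<nu> ^ d" using b by (simp flip: norm_power)
    then show ?thesis
      using \<nu> power_strict_decreasing[of _ _ "cmod \<nu>"] by (metis linorder_neqE_nat less_irrefl)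
  qed
  define D where "D = {\<alpha> :: 'a \<Rightarrow> nat. (\<Sum>i\<in>UNIV. \<alpha> i) = d}"
  define p where "p z = (\<chi> k. \<Sum>\<alpha>\<in>D. (if \<alpha> \<in> E k then a k \<alpha> else 0) * monomial_fun \<alpha> z)" for z
  have p: "p z = g z" if z: "z \<in> punctured_space" for z
  proof -
    have "(\<Sum>\<alpha>\<in>E k. a k \<alpha> * monomial_fun \<alpha> z)
        = (\<Sum>\<alpha>\<in>D. (if \<alpha> \<in> E k then a k \<alpha> else 0) * monomial_fun \<alpha> z)" for k
      by (rule sum.mono_neutral_cong_left)
         (use deg finite_exponents_of_degree in \<open>auto simp: D_def\<close>)
    then show ?thesis by (simp add: vec_eq_iff p_def E(2)[OF z])
  qed
  have p_nz: "p z \<noteq> 0" if "z \<noteq> 0" for z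
  proof -
    have z: "z \<in> punctured_space" using that by (simp add: punctured_space_def)
    then have "g z \<noteq> 0" using g unfolding induced_by_def by blast
    then show ?thesis by (simp add: p[OF z])
  qed
  have "{z. \<forall>i. p z $ i = 0} = (if d = 0 then {} else {0})"
  proof (cases "d = 0")
    case True
    then have "monomial_fun \<alpha> 0 = monomial_fun \<alpha> (axis undefined 1)" if "\<alpha> \<in> D" for \<alpha>
      using that by (simp add: D_def monomial_fun_def)
    then have "p 0 = p (axis undefined 1)" by (simp add: p_def)
    then have "p z \<noteq> 0" for z
      using p_nz[of "axis undefined 1"] p_nz[of z] by (cases "z = 0") (auto simp: axis_eq_0_iff)
    then show ?thesis using True by (auto simp: vec_eq_iff)
  next
    case False
    have "monomial_fun \<alpha> 0 = 0" if "\<alpha> \<in> D" for \<alpha>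
    proof -
      have "(\<Sum>i\<in>UNIV. \<alpha> i) \<noteq> 0" using that False by (simp add: D_def)
      then obtain i where "\<alpha> i \<noteq> 0" by (rule sum.not_neutral_contains_not_neutral)
      then show ?thesis unfolding monomial_fun_def by (intro prod_zero) auto
    qed
    then have "p 0 = 0" by (simp add: p_def vec_eq_iff)
    then have "p z = 0 \<longleftrightarrow> z = 0" for z using p_nz by metis
    then show ?thesis using False by (auto simp: vec_eq_iff)
  qed
  moreover have "homogeneous_polynomial d (\<lambda>z. p z $ k)" for k
    unfolding homogeneous_polynomial_def
    by (rule exI[of _ "\<lambda>\<alpha>. if \<alpha> \<in> E k then a k \<alpha> else 0"]) (simp add: p_def D_def monomial_fun_def)
  moreover have "induced_by \<mu> b \<F> p" by (rule induced_by_cong[OF g _ hopf]) (rule p)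
  moreover have "b = \<nu> powi (- (int d - 1))"
    using d \<nu> by (simp add: power_int_diff field_simps)
  ultimately show ?thesis by (intro exI[of _ "int d - 1"] conjI exI[of _ p]) auto
qed

section \<open>Generic and intermediary Hopf manifolds\<close>

text \<open>
  All classes are singletons here, so linear fields are diagonal and constant fields are multiples
  of one coordinate field.
\<close>

lemma generic_foliation:
  assumes gen: "generic_hopf \<mu>" and b: "b \<noteq> 0" and g: "induced_by \<mu> b \<F> g"
  shows "b \<in> {1} \<union> range (\<lambda>i. \<mu> $ i) \<and>
         (b \<noteq> 1 \<longrightarrow> (\<exists>c. induced_by \<mu> b \<F> (\<lambda>z. c))) \<and>
         (b = 1 \<longrightarrow> (\<exists>c. induced_by \<mu> b \<F> (\<lambda>z. \<chi> k. c k * z $ k)))"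
proof (intro conjI impI)
  have hopf: "hopf_data \<mu>" and rel: "no_nontrivial_relation \<mu> UNIV"
    using gen by (auto simp: generic_hopf_def)
  note classes = hopf UNIV_I refl rel
  have "\<not> CARD('a) \<le> 1" using hopf by (simp add: hopf_data_def)
  then obtain i j :: 'a where "i \<noteq> j" by (auto simp: card_le_Suc0_iff_eq)
  with twist_is_one_or_multiplier[where \<kappa> = "\<lambda>i. i", OF classes b g, of i j]
  have twist: "b = 1 \<or> (\<exists>k. b = \<mu> $ k)" by simp
  then show "b \<in> {1} \<union> range (\<lambda>i. \<mu> $ i)" by auto
  show "\<exists>c. induced_by \<mu> b \<F> (\<lambda>z. c)" if b_ne: "b \<noteq> 1"
  proof -
    obtain l where l: "b = \<mu> $ l" using twist b_ne by blast
    obtain c where c: "\<forall>k. \<forall>z\<in>punctured_space. g z $ k = (if k = l then c k else 0)"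
      using constant_vector_field[where \<kappa> = "\<lambda>i. i", OF classes g[unfolded l]] by blast
    note c = c[rule_format]
    then have "induced_by \<mu> b \<F> (\<lambda>z. \<chi> k. if k = l then c k else 0)"
      by (intro induced_by_cong[OF g _ hopf]) (simp add: vec_eq_iff c)
    then show ?thesis by blast
  qed
  show "\<exists>c. induced_by \<mu> b \<F> (\<lambda>z. \<chi> k. c k * z $ k)" if b1: "b = 1"
  proof -
    obtain c where c: "\<forall>k. \<forall>z\<in>punctured_space. g z $ k = (\<Sum>i | i = k. c k i * z $ i)"
      using linear_vector_field[where \<kappa> = "\<lambda>i. i", OF classes g[unfolded b1]] by blast
    note c = c[rule_format]
    then have "induced_by \<mu> b \<F> (\<lambda>z. \<chi> k. c k k * z $ k)"
      by (intro induced_by_cong[OF g _ hopf]) (simp add: vec_eq_iff c)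
    then show ?thesis by (rule exI[of _ "\<lambda>k. c k k"])
  qed
qed

lemma position_first: "position (Min UNIV :: 'n::{finite,linorder}) = 1"
proof -
  have "{..Min UNIV :: 'n} = {Min UNIV}" by (auto intro: antisym)
  then show ?thesis by (simp add: position_def)
qed

lemma position_last: "position (Max UNIV :: 'n::{finite,linorder}) = CARD('n)"
proof -
  have "{..Max UNIV :: 'n} = UNIV" by auto
  then show ?thesis by (simp add: position_def)
qed

text \<open>
  One class consists of the indices at positions up to \<open>r\<close>, and all other classes are singletons.
  Because \<open>r < n\<close>, the first and the last index lie in different classes.
\<close>

lemma intermediary_foliation:
  assumes int: "intermediary_hopf \<mu> r" and b: "b \<noteq> 0" and g: "induced_by \<mu> b \<F> g"
  shows "b \<in> {1} \<union> {\<mu> $ i | i. position i = 1 \<or> r < position i} \<and>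
     (b = 1 \<longrightarrow>
        (\<exists>g c. (\<forall>j z w. position j \<le> r \<and> (\<forall>i. position i \<le> r \<longrightarrow> z $ i = w $ i)
                   \<longrightarrow> g z $ j = g w $ j) \<and>
               (\<forall>k z. r < position k \<longrightarrow> g z $ k = c k * z $ k) \<and>
               induced_by \<mu> b \<F> g)) \<and>
     (\<forall>i. position i = 1 \<and> b = \<mu> $ i \<longrightarrow>
        (\<exists>c. (\<exists>j. position j \<le> r \<and> c j \<noteq> 0) \<and>
             induced_by \<mu> b \<F> (\<lambda>z. \<chi> k. if position k \<le> r then c k else 0))) \<and>
     (\<forall>j. r < position j \<and> b = \<mu> $ j \<longrightarrow> induced_by \<mu> b \<F> (\<lambda>z. axis j 1))"
proof -
  define first :: 'a where "first = Min UNIV"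
  define S where "S = {i :: 'a. position i = 1 \<or> r < position i}"
  define \<kappa> where "\<kappa> i = (if position i \<le> r then first else i)" for i :: 'a
  have hopf: "hopf_data \<mu>" and r: "2 \<le> r" "r \<le> CARD('a) - 1" and rel: "no_nontrivial_relation \<mu> S"
    and same: "\<And>i j. position i \<le> r \<Longrightarrow> position j \<le> r \<Longrightarrow> \<mu> $ i = \<mu> $ j"
    using int unfolding intermediary_hopf_def S_def by blast+
  have first: "position first = 1" by (simp add: first_def position_first)
  have last: "r < position (Max UNIV :: 'a)"
    using r hopf by (simp add: position_last hopf_data_def)
  have S: "\<kappa> i \<in> S" for i using first by (auto simp: \<kappa>_def S_def)
  have \<mu>_\<kappa>: "\<mu> $ \<kappa> i = \<mu> $ i" for i using same[of i first] first r by (auto simp: \<kappa>_def)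
  note classes = hopf S \<mu>_\<kappa> rel
  have \<kappa>_low: "\<kappa> i = \<kappa> j \<longleftrightarrow> position i \<le> r" if "position j \<le> r" for i j
    using that first r by (auto simp: \<kappa>_def)
  have \<kappa>_high: "\<kappa> i = \<kappa> j \<longleftrightarrow> i = j" if "r < position j" for i j
    using that first r by (auto simp: \<kappa>_def)
  have nz: "\<exists>k. g z $ k \<noteq> 0" if "z \<in> punctured_space" for z
  proof -
    have "g z \<noteq> 0" using g that unfolding induced_by_def by blast
    then show ?thesis by (simp add: vec_eq_iff)
  qed
  have e: "axis first 1 \<in> punctured_space" by (simp add: punctured_space_def axis_eq_0_iff)
  have "\<kappa> first \<noteq> \<kappa> (Max UNIV)" using \<kappa>_high[OF last, of first] last first r by auto
  then have "b = 1 \<or> (\<exists>k. b = \<mu> $ k)" by (rule twist_is_one_or_multiplier[OF classes b g])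
  then have "b = 1 \<or> (\<exists>k. b = \<mu> $ \<kappa> k)" by (simp add: \<mu>_\<kappa>)
  then have "b \<in> {1} \<union> {\<mu> $ i | i. position i = 1 \<or> r < position i}"
    using S unfolding S_def by blast
  moreover have "\<exists>g c. (\<forall>j z w. position j \<le> r \<and> (\<forall>i. position i \<le> r \<longrightarrow> z $ i = w $ i)
                   \<longrightarrow> g z $ j = g w $ j) \<and>
               (\<forall>k z. r < position k \<longrightarrow> g z $ k = c k * z $ k) \<and>
               induced_by \<mu> b \<F> g" if b1: "b = 1"
  proof -
    obtain c where c: "\<forall>k. \<forall>z\<in>punctured_space. g z $ k = (\<Sum>i | \<kappa> i = \<kappa> k. c k i * z $ i)"
      using linear_vector_field[OF classes g[unfolded b1]] by blast
    note c = c[rule_format]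
    define p where "p z = (\<chi> k. \<Sum>i | \<kappa> i = \<kappa> k. c k i * z $ i)" for z
    have "induced_by \<mu> b \<F> p"
      by (rule induced_by_cong[OF g _ hopf]) (simp add: p_def vec_eq_iff c)
    moreover have "p z $ j = p w $ j"
      if "position j \<le> r" "\<forall>i. position i \<le> r \<longrightarrow> z $ i = w $ i" for j z w
      using that by (simp add: p_def \<kappa>_low)
    moreover have "p z $ k = c k k * z $ k" if "r < position k" for k z
      using that by (simp add: p_def \<kappa>_high)
    ultimately show ?thesis by (intro exI[of _ p] exI[of _ "\<lambda>k. c k k"]) auto
  qed
  moreover have "\<exists>c. (\<exists>j. position j \<le> r \<and> c j \<noteq> 0) \<and>
        induced_by \<mu> b \<F> (\<lambda>z. \<chi> k. if position k \<le> r then c k else 0)"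
    if i: "position i = 1" "b = \<mu> $ i" for i
  proof -
    have i_r: "position i \<le> r" using i r by simp
    obtain c where c: "\<forall>k. \<forall>z\<in>punctured_space. g z $ k = (if \<kappa> k = \<kappa> i then c k else 0)"
      using constant_vector_field[OF classes g[unfolded i(2)]] by blast
    note c = c[rule_format]
    have "induced_by \<mu> b \<F> (\<lambda>z. \<chi> k. if position k \<le> r then c k else 0)"
      by (rule induced_by_cong[OF g _ hopf]) (simp add: vec_eq_iff c \<kappa>_low[OF i_r])
    moreover obtain k where "g (axis first 1) $ k \<noteq> 0" using nz[OF e] by blast
    ultimately show ?thesis
      using c[OF e, of k] by (auto simp: \<kappa>_low[OF i_r] split: if_splits)
  qed
  moreover have "induced_by \<mu> b \<F> (\<lambda>z. axis j 1)" if j: "r < position j" "b = \<mu> $ j" for j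
  proof -
    obtain c where c: "\<forall>k. \<forall>z\<in>punctured_space. g z $ k = (if \<kappa> k = \<kappa> j then c k else 0)"
      using constant_vector_field[OF classes g[unfolded j(2)]] by blast
    note c = c[rule_format]
    have "induced_by \<mu> b \<F> (\<lambda>z. c j *s axis j 1)"
      by (rule induced_by_cong[OF g _ hopf]) (auto simp: vec_eq_iff c \<kappa>_high[OF j(1)] axis_def)
    moreover have "c j \<noteq> 0"
      using nz[OF e] c[OF e] by (auto simp: \<kappa>_high[OF j(1)] split: if_splits)
    ultimately show ?thesis by (rule induced_by_rescale)
  qed
  ultimately show ?thesis by blast
qed

section \<open>The classification\<close>

theorem theorem1p2:
  fixes \<mu> :: "complex^'n::{finite,linorder}"
    and b :: complex
    and \<F> :: "((complex^'n::{finite,linorder}) \<times> (complex^'n::{finite,linorder})) set set"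
  assumes "CARD('n) \<ge> 3"
    and "hopf_data \<mu>"
    and "b \<noteq> 0"
    and "nonsingular_foliation \<mu> b \<F>"
  shows "(\<forall>\<nu>. classical_hopf \<mu> \<nu> \<longrightarrow>
            (\<exists>m::int. m \<ge> -1 \<and> b = \<nu> powi (- m) \<and>
               (\<exists>g. (\<forall>i. homogeneous_polynomial (nat (m + 1)) (\<lambda>z. g z $ i)) \<and>
                    {z. \<forall>i. g z $ i = 0} = (if m = -1 then {} else {0}) \<and>
                    induced_by \<mu> b \<F> g)))
       \<and> (generic_hopf \<mu> \<longrightarrow>
            b \<in> {1} \<union> range (\<lambda>i. \<mu> $ i) \<and>
            (b \<noteq> 1 \<longrightarrow> (\<exists>c. induced_by \<mu> b \<F> (\<lambda>z. c))) \<and>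
            (b = 1 \<longrightarrow> (\<exists>c. induced_by \<mu> b \<F> (\<lambda>z. \<chi> k. c k * z $ k))))
       \<and> (\<forall>r. intermediary_hopf \<mu> r \<longrightarrow>
            b \<in> {1} \<union> {\<mu> $ i | i. position i = 1 \<or> r < position i} \<and>
            (b = 1 \<longrightarrow>
               (\<exists>g c. (\<forall>j z w. position j \<le> r \<and> (\<forall>i. position i \<le> r \<longrightarrow> z $ i = w $ i)
                          \<longrightarrow> g z $ j = g w $ j) \<and>
                      (\<forall>k z. r < position k \<longrightarrow> g z $ k = c k * z $ k) \<and>
                      induced_by \<mu> b \<F> g)) \<and>
            (\<forall>i. position i = 1 \<and> b = \<mu> $ i \<longrightarrow>
               (\<exists>c. (\<exists>j. position j \<le> r \<and> c j \<noteq> 0) \<and>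
                    induced_by \<mu> b \<F> (\<lambda>z. \<chi> k. if position k \<le> r then c k else 0))) \<and>
            (\<forall>j. r < position j \<and> b = \<mu> $ j \<longrightarrow>
               induced_by \<mu> b \<F> (\<lambda>z. axis j 1)))"
proof -
  obtain g where "induced_by \<mu> b \<F> g"
    using foliation_induced_by_vector_field assms(2-4) by blast
  note g = assms(3) this
  show ?thesis
    by (intro conjI allI impI classical_foliation[OF _ g] generic_foliation[OF _ g]
        intermediary_foliation[OF _ g])
qed

end
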